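(* Every compactum defined by one building block is a Markov compactum. That is, if $X$ is a compactum defined by a building block $f:L\to\Delta^n$, then $X$ is the limit of a Markov inverse sequence of simplicial complexes.
   Context: Markov compacta. Let $S=\{K_i,\phi^{i+1}_i\}_{i\ge 0}$ be an inverse sequence of finite simplicial complexes whose bonding maps $\phi^{i+1}_i:K_{i+1}\to K_i$ are simplicial with respect to some subdivision of $K_i$; for $j\geq i$ let $\phi^j_i:K_j\to K_i$ be the composition of bonding maps. Call simplices $\sigma\subset K_i$ and $\sigma'\subset K_j$ equivalent if the inverse sequences $\{\sigma\leftarrow(\phi^{i+1}_i)^{-1}(\sigma)\leftarrow(\phi^{i+2}_i)^{-1}(\sigma)\leftarrow\cdots\}$ and $\{\sigma'\leftarrow(\phi^{j+1}_j)^{-1}(\sigma')\leftarrow(\phi^{j+2}_j)^{-1}(\sigma')\leftarrow\cdots\}$ (with bonding maps the restrictions of the $\phi$'s) are isomorphic, i.e. there are homeomorphisms between corresponding terms commuting with the bonding maps. $S$ is Markov if this equivalence relation on the set of all simplices of $\coprod_i K_i$ has finitely many classes. A compactum is Markov if it is the limit of a Markov inverse sequence. Building blocks. A map is light if all its point preimages are at most $0$-dimensional. $\Delta^n$ is the $n$-simplex with ordered vertices $e_0,\dots,e_n$. A complex over $\Delta^n$ is an $n$-dimensional simplicial complex $K$ together with a light simplicial map $\chi:K\to\Delta^n$ (the characteristic map). The barycentric subdivision $\beta K$ of an $n$-dimensional simplicial complex $K$ is a complex over $\Delta^n$ with characteristic map sending the barycenter $b_\sigma$ of a simplex $\sigma$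 of $K$ to $e_{\dim\sigma}$. A triangulation $\tau$ of $\Delta^n$ is symmetric if it is invariant under the natural action of the symmetric group $S_{n+1}$ on $\Delta^n$; such a $\tau$ induces a subdivision $\tau_K$ of every complex $K$ over $\Delta^n$. A building block is a surjective map $f:L\to\Delta^n$ from a finite $n$-dimensional simplicial complex $L$ that is simplicial with respect to a symmetric triangulation $\tau$ of $\Delta^n$. Given a finite complex $K_0$ over $\Delta^n$ with characteristic map $\chi_0$, define inductively $K_{i+1}$ as the pull-back $\{(x,y)\in K_i\times L:\chi_i(x)=f(y)\}$ with projection $\phi^{i+1}_i:K_{i+1}\to K_i$. It has a natural simplicial structure for which $\phi^{i+1}_i$ is simplicial with respect to $\tau_{K_i}$; the triangulation on $K_{i+1}$ is then taken to be the first barycentric subdivision of this structure, with the corresponding natural characteristic map $\chi_{i+1}:K_{i+1}\to\Delta^n$. The limit of $\{K_i,\phi^{i+1}_i\}$ is called a compactum defined by the building block $f$ (with initial complex $K_0$). *)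

theory Defs
  imports "HOL-Analysis.Analysis" "HOL-Analysis.Finite_Function_Topology"
begin

section \<open>Finite simplicial complexes\<close>

text \<open>
  A finite geometric simplicial complex is encoded by the set of the vertex sets of its
  (nonempty) simplices; the simplex with vertex set \<open>V\<close> is \<open>convex hull V\<close>.
  The library's \<open>simplicial_complex\<close> is confined to a fixed Euclidean space, whereas the
  iterated pull-backs below need unboundedly many coordinates.
\<close>

definition finite_complex :: "'a::real_vector set set \<Rightarrow> bool" where
  "finite_complex K \<longleftrightarrow>
     finite K \<and>
     (\<forall>V\<in>K. finite V \<and> V \<noteq> {} \<and> \<not> affine_dependent V) \<and>
     (\<forall>V\<in>K. \<forall>W. W \<subseteq> V \<and> W \<noteq> {} \<longrightarrow> W \<in> K) \<and>
     (\<forall>V\<in>K. \<forall>W\<in>K. convex hull V \<inter> convex hull W = convex hull (V \<inter> W))"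

definition underlying :: "'a::real_vector set set \<Rightarrow> 'a set" where
  "underlying K = (\<Union>V\<in>K. convex hull V)"

definition n_dimensional :: "nat \<Rightarrow> 'a set set \<Rightarrow> bool" where
  "n_dimensional n K \<longleftrightarrow> (\<forall>V\<in>K. card V \<le> n + 1) \<and> (\<exists>V\<in>K. card V = n + 1)"

definition subdivides :: "'a::real_vector set set \<Rightarrow> 'a set set \<Rightarrow> bool" where
  "subdivides K' K \<longleftrightarrow>
     finite_complex K' \<and> finite_complex K \<and> underlying K' = underlying K \<and>
     (\<forall>V\<in>K'. \<exists>W\<in>K. convex hull V \<subseteq> convex hull W)"

definition affine_on_simplex :: "'a::real_vector set \<Rightarrow> ('a \<Rightarrow> 'b::real_vector) \<Rightarrow> bool" where
  "affine_on_simplex V g \<longleftrightarrow>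
     (\<forall>u. (\<forall>v\<in>V. 0 \<le> u v) \<and> sum u V = (1::real) \<longrightarrow>
        g (\<Sum>v\<in>V. u v *\<^sub>R v) = (\<Sum>v\<in>V. u v *\<^sub>R g v))"

text \<open>
  Maps of polyhedra are total functions of which only the values on the polyhedron matter.
\<close>

definition simplicial_map ::
  "'a::real_vector set set \<Rightarrow> 'b::real_vector set set \<Rightarrow> ('a \<Rightarrow> 'b) \<Rightarrow> bool" where
  "simplicial_map K K' g \<longleftrightarrow> (\<forall>V\<in>K. g ` V \<in> K' \<and> affine_on_simplex V g)"

definition simplicial_extension ::
  "'a::real_vector set set \<Rightarrow> ('a \<Rightarrow> 'b::real_vector) \<Rightarrow> 'a \<Rightarrow> 'b" where
  "simplicial_extension K g x =
     (THE y. \<exists>V\<in>K. \<exists>u. (\<forall>v\<in>V. 0 \<le> u v) \<and> sum u V = (1::real) \<and>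
        x = (\<Sum>v\<in>V. u v *\<^sub>R v) \<and> y = (\<Sum>v\<in>V. u v *\<^sub>R g v))"

definition barycenter :: "'a::real_vector set \<Rightarrow> 'a" where
  "barycenter V = (1 / real (card V)) *\<^sub>R (\<Sum>v\<in>V. v)"

definition barycentric_subdivision :: "'a::real_vector set set \<Rightarrow> 'a set set" where
  "barycentric_subdivision K =
     {barycenter ` C | C. C \<subseteq> K \<and> C \<noteq> {} \<and> (\<forall>V\<in>C. \<forall>W\<in>C. V \<subseteq> W \<or> W \<subseteq> V)}"


section \<open>Inverse sequences and Markov compacta\<close>

definition inverse_sequence ::
  "(nat \<Rightarrow> 'a::real_vector set set) \<Rightarrow> (nat \<Rightarrow> 'a \<Rightarrow> 'a) \<Rightarrow> bool" where
  "inverse_sequence K \<phi> \<longleftrightarrow>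
     (\<forall>i. finite_complex (K i) \<and>
          (\<exists>K'. subdivides K' (K i) \<and> simplicial_map (K (Suc i)) K' (\<phi> i)))"

text \<open>\<open>bonding \<phi> i k\<close> is the composite from stage \<open>i + k\<close> to stage \<open>i\<close>.\<close>

primrec bonding :: "(nat \<Rightarrow> 'a \<Rightarrow> 'a) \<Rightarrow> nat \<Rightarrow> nat \<Rightarrow> 'a \<Rightarrow> 'a" where
  "bonding \<phi> i 0 = id"
| "bonding \<phi> i (Suc k) = bonding \<phi> i k \<circ> \<phi> (i + k)"

definition simplex_preimage ::
  "(nat \<Rightarrow> 'a::real_vector set set) \<Rightarrow> (nat \<Rightarrow> 'a \<Rightarrow> 'a) \<Rightarrow> nat \<Rightarrow> 'a set \<Rightarrow> nat \<Rightarrow> 'a set" where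
  "simplex_preimage K \<phi> i V k = {x \<in> underlying (K (i + k)). bonding \<phi> i k x \<in> convex hull V}"

definition all_simplices :: "(nat \<Rightarrow> 'a set set) \<Rightarrow> (nat \<times> 'a set) set" where
  "all_simplices K = {(i, V). V \<in> K i}"

definition simplex_equiv ::
  "(nat \<Rightarrow> 'a::real_normed_vector set set) \<Rightarrow> (nat \<Rightarrow> 'a \<Rightarrow> 'a) \<Rightarrow> (nat \<times> 'a set) rel" where
  "simplex_equiv K \<phi> =
     {((i, V), (j, W)). V \<in> K i \<and> W \<in> K j \<and>
        (\<exists>h g. \<forall>k.
           homeomorphism (simplex_preimage K \<phi> i V k) (simplex_preimage K \<phi> j W k) (h k) (g k) \<and>
           (\<forall>x \<in> simplex_preimage K \<phi> i V (Suc k).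
              h k (\<phi> (i + k) x) = \<phi> (j + k) (h (Suc k) x)))}"

definition markov_sequence ::
  "(nat \<Rightarrow> 'a::real_normed_vector set set) \<Rightarrow> (nat \<Rightarrow> 'a \<Rightarrow> 'a) \<Rightarrow> bool" where
  "markov_sequence K \<phi> \<longleftrightarrow>
     inverse_sequence K \<phi> \<and> finite (all_simplices K // simplex_equiv K \<phi>)"

definition inverse_limit ::
  "(nat \<Rightarrow> 'a::real_normed_vector set set) \<Rightarrow> (nat \<Rightarrow> 'a \<Rightarrow> 'a) \<Rightarrow> (nat \<Rightarrow> 'a) topology" where
  "inverse_limit K \<phi> =
     subtopology (product_topology (\<lambda>i. top_of_set (underlying (K i))) UNIV)
       {x. \<forall>i. \<phi> i (x (Suc i)) = x i}"

text \<open>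
  Every finite simplicial complex has an isomorphic copy in the space of finitely supported
  real sequences, so complexes in this space suffice. On finite-dimensional subspaces, hence on
  finite complexes, the norm topology of the space is the usual one.
\<close>

type_synonym rinf = "nat \<Rightarrow>\<^sub>0 real"

definition markov_compactum :: "'x topology \<Rightarrow> bool" where
  "markov_compactum X \<longleftrightarrow>
     compact_space X \<and> metrizable_space X \<and>
     (\<exists>(K :: nat \<Rightarrow> rinf set set) \<phi>. markov_sequence K \<phi> \<and> X homeomorphic_space inverse_limit K \<phi>)"


section \<open>Building blocks\<close>

definition unit_vertex :: "nat \<Rightarrow> rinf" where
  "unit_vertex i = Poly_Mapping.single i 1"

definition std_simplex :: "nat \<Rightarrow> rinf set set" where
  "std_simplex n = {V. V \<noteq> {} \<and> V \<subseteq> unit_vertex ` {..n}}"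

definition light_on :: "'a::topological_space set \<Rightarrow> ('a \<Rightarrow> 'b) \<Rightarrow> bool" where
  "light_on S g \<longleftrightarrow> (\<forall>y. top_of_set {x \<in> S. g x = y} dim_le 0)"

definition complex_over :: "nat \<Rightarrow> rinf set set \<Rightarrow> (rinf \<Rightarrow> rinf) \<Rightarrow> bool" where
  "complex_over n K \<kappa> \<longleftrightarrow>
     finite_complex K \<and> n_dimensional n K \<and>
     simplicial_map K (std_simplex n) \<kappa> \<and> light_on (underlying K) \<kappa>"

text \<open>The symmetric group acts by permuting the coordinates with indices \<open>0, \<dots>, n\<close>.\<close>

definition symmetric_triangulation :: "nat \<Rightarrow> rinf set set \<Rightarrow> bool" where
  "symmetric_triangulation n \<tau> \<longleftrightarrow>
     finite_complex \<tau> \<and> underlying \<tau> = underlying (std_simplex n) \<and>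
     (\<forall>p. p permutes {..n} \<longrightarrow> (\<forall>T\<in>\<tau>. Poly_Mapping.map_key p ` T \<in> \<tau>))"

definition building_block ::
  "nat \<Rightarrow> rinf set set \<Rightarrow> rinf set set \<Rightarrow> (rinf \<Rightarrow> rinf) \<Rightarrow> bool" where
  "building_block n L \<tau> f \<longleftrightarrow>
     finite_complex L \<and> n_dimensional n L \<and> symmetric_triangulation n \<tau> \<and>
     simplicial_map L \<tau> f \<and> f ` underlying L = underlying (std_simplex n)"

text \<open>
  The subdivision of a complex over the standard simplex induced by \<open>\<tau>\<close>: the characteristic
  map is an affine isomorphism from each simplex onto a face, along which the simplices of \<open>\<tau>\<close>
  lying in that face are pulled back.
\<close>

definition induced_subdivision ::
  "rinf set set \<Rightarrow> rinf set set \<Rightarrow> (rinf \<Rightarrow> rinf) \<Rightarrow> rinf set set" where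
  "induced_subdivision \<tau> K \<kappa> =
     {{x \<in> convex hull V. \<kappa> x \<in> T} | V T. V \<in> K \<and> T \<in> \<tau> \<and> T \<subseteq> convex hull (\<kappa> ` V)}"

text \<open>
  The even and the odd coordinates identify \<open>rinf\<close> with \<open>rinf \<times> rinf\<close>. Through this linear
  isomorphism the product of two polyhedra in \<open>rinf\<close> lies again in \<open>rinf\<close>, with
  \<open>pr1\<close> and \<open>pr2\<close> as the projections.
\<close>

definition pr1 :: "rinf \<Rightarrow> rinf" where
  "pr1 z = Poly_Mapping.map_key (\<lambda>k. 2 * k) z"

definition pr2 :: "rinf \<Rightarrow> rinf" where
  "pr2 z = Poly_Mapping.map_key (\<lambda>k. 2 * k + 1) z"

text \<open>
  The natural simplicial structure on the pull-back
  \<open>{z. pr1 z \<in> underlying K \<and> pr2 z \<in> underlying L \<and> \<kappa> (pr1 z) = f (pr2 z)}\<close>: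
  its simplices are the pull-backs of a simplex \<open>S\<close> of the induced subdivision and a simplex \<open>W\<close>
  of \<open>L\<close> over the same simplex of \<open>\<tau>\<close>. Since \<open>\<kappa>\<close> is injective on \<open>S\<close>, such a
  pull-back projects isomorphically onto \<open>W\<close>, and its vertices are the pairs of vertices of \<open>S\<close>
  and \<open>W\<close> with equal images.
\<close>

definition pullback_complex ::
  "rinf set set \<Rightarrow> rinf set set \<Rightarrow> (rinf \<Rightarrow> rinf) \<Rightarrow> rinf set set \<Rightarrow> (rinf \<Rightarrow> rinf) \<Rightarrow> rinf set set" where
  "pullback_complex L \<tau> f K \<kappa> =
     {{z. pr1 z \<in> S \<and> pr2 z \<in> W \<and> \<kappa> (pr1 z) = f (pr2 z)} | S W.
        S \<in> induced_subdivision \<tau> K \<kappa> \<and> W \<in> L \<and> \<kappa> ` S = f ` W}"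

definition barycentric_char :: "rinf set set \<Rightarrow> rinf \<Rightarrow> rinf" where
  "barycentric_char K =
     simplicial_extension (barycentric_subdivision K)
       (\<lambda>b. unit_vertex (card (inv_into K barycenter b) - 1))"

primrec block_stage ::
  "rinf set set \<Rightarrow> rinf set set \<Rightarrow> (rinf \<Rightarrow> rinf) \<Rightarrow> rinf set set \<Rightarrow> (rinf \<Rightarrow> rinf) \<Rightarrow>
   nat \<Rightarrow> rinf set set \<times> (rinf \<Rightarrow> rinf)" where
  "block_stage L \<tau> f K\<^sub>0 \<kappa>\<^sub>0 0 = (K\<^sub>0, \<kappa>\<^sub>0)"
| "block_stage L \<tau> f K\<^sub>0 \<kappa>\<^sub>0 (Suc i) =
     (let (K, \<kappa>) = block_stage L \<tau> f K\<^sub>0 \<kappa>\<^sub>0 i;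
          M = pullback_complex L \<tau> f K \<kappa>
      in (barycentric_subdivision M, barycentric_char M))"

definition compactum_defined_by ::
  "nat \<Rightarrow> rinf set set \<Rightarrow> rinf set set \<Rightarrow> (rinf \<Rightarrow> rinf) \<Rightarrow> 'x topology \<Rightarrow> bool" where
  "compactum_defined_by n L \<tau> f X \<longleftrightarrow>
     (\<exists>K\<^sub>0 \<kappa>\<^sub>0. complex_over n K\<^sub>0 \<kappa>\<^sub>0 \<and>
        X homeomorphic_space inverse_limit (\<lambda>i. fst (block_stage L \<tau> f K\<^sub>0 \<kappa>\<^sub>0 i)) (\<lambda>i. pr1))"

end

theory Submission
  imports Defs
begin

text \<open>
  One step of the construction sends a complex \<open>M\<close> of dimension at most \<open>n\<close> to the pull-back of
  \<open>f\<close> along the characteristic map of the barycentric subdivision of \<open>M\<close>. This characteristic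
  map records only the dimensions of the members of a flag, so the step is functorial for
  simplicial maps that are injective on simplices. Applied to the inclusion of a face this shows
  that the tower over a simplex \<open>V\<close> is the tower generated by \<open>V\<close> alone, and applied to an affine
  isomorphism it shows that this tower depends only on \<open>dim V\<close>. Hence the simplices of all the
  later stages fall into at most \<open>n + 1\<close> classes.

  The triangulation matters: where \<open>f\<close> collapses a simplex, the projection to the previous stage
  is not simplicial on the barycentric subdivision of the pull-back. The Markov sequence
  therefore carries the natural simplicial structures of the pull-backs, on the same spaces and
  with the same bonding maps.
\<close>


section \<open>Barycentric coordinates\<close>

text \<open>Stage zero escapes this argument: \<open>\<kappa>\<^sub>0\<close> is any nondegenerate
  simplicial map, not a record of dimensions, so the preimages of a simplex of
  \<open>K\<^sub>0\<close> depend on where its vertices go. As \<open>K\<^sub>0\<close> is finite,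
  its simplices are simply counted one by one. Why barycentric subdivisions fail as stages: if
  \<open>f\<close> collapses the edge ab of a triangle abc but not the whole triangle,
  \<open>pr1\<close> maps the pulled-back triangle onto a segment and sends the barycenters of the
  flag a, ac, abc to the points at 0, 1/2 and 1/3 of it. Three distinct collinear points are the
  vertices of no simplex, whatever subdivision is chosen below. On the natural structure vertices go
  to vertices. Maps such as \<open>f\<close> and \<open>pr1\<close> may collapse simplices, whereas
  the characteristic maps do not. The constructions are therefore shown to be complexes by pushing
  coordinates forward, adding weights over fibres, and by undoing this only along maps that are
  injective on a simplex. In this way uniqueness of coordinates in \<open>\<tau>\<close> and in
  \<open>L\<close> lifts to the pull-back.\<close>

definition coords :: "'a::real_vector set \<Rightarrow> ('a \<Rightarrow> real) \<Rightarrow> 'a \<Rightarrow> bool" where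
  "coords V u x \<longleftrightarrow>
     (\<forall>v. 0 \<le> u v) \<and> (\<forall>v. v \<notin> V \<longrightarrow> u v = 0) \<and> sum u V = 1 \<and> (\<Sum>v\<in>V. u v *\<^sub>R v) = x"

lemma in_convex_hull_iff_coords:
  assumes "finite V"
  shows "x \<in> convex hull V \<longleftrightarrow> (\<exists>u. coords V u x)"
proof
  assume "x \<in> convex hull V"
  then obtain u where u: "\<forall>v\<in>V. 0 \<le> u v" "sum u V = 1" "(\<Sum>v\<in>V. u v *\<^sub>R v) = x"
    using assms by (auto simp: convex_hull_finite)
  have "coords V (\<lambda>v. if v \<in> V then u v else 0) x"
    using u unfolding coords_def by (auto cong: sum.cong)
  then show "\<exists>u. coords V u x" by blast
next
  assume "\<exists>u. coords V u x"
  then show "x \<in> convex hull V"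
    using assms by (auto simp: convex_hull_finite coords_def)
qed

lemma coords_nonempty: "coords V u x \<Longrightarrow> V \<noteq> {}"
  by (auto simp: coords_def)

lemma coords_nonneg: "coords V u x \<Longrightarrow> 0 \<le> u v"
  by (simp add: coords_def)

lemma coords_outside: "coords V u x \<Longrightarrow> v \<notin> V \<Longrightarrow> u v = 0"
  by (simp add: coords_def)

lemma coords_sum: "coords V u x \<Longrightarrow> (\<Sum>v\<in>V. u v *\<^sub>R v) = x"
  by (simp add: coords_def)

text \<open>Both sums reduce to the support of \<open>u\<close>, so \<open>W\<close> may be smaller
  or larger than \<open>V\<close>. Since \<open>coords\<close> makes \<open>u\<close> vanish off its
  simplex, coordinates taken in different simplices can be compared as total functions.\<close>

lemma coords_mono:
  assumes "coords V u x" "{v. u v \<noteq> 0} \<subseteq> W" "finite V" "finite W"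
  shows "coords W u x"
proof -
  let ?S = "{v. u v \<noteq> 0}"
  have V: "?S \<subseteq> V"
    using assms(1) by (auto simp: coords_def)
  have "sum u ?S = sum u V" "sum u ?S = sum u W"
    "(\<Sum>v\<in>?S. u v *\<^sub>R v) = (\<Sum>v\<in>V. u v *\<^sub>R v)"
    "(\<Sum>v\<in>?S. u v *\<^sub>R v) = (\<Sum>v\<in>W. u v *\<^sub>R v)"
    using V assms(2-4) by (intro sum.mono_neutral_left; auto)+
  then show ?thesis
    using assms by (auto simp: coords_def)
qed

lemma coords_support:
  assumes "coords V u x" "finite V"
  shows "coords {v. u v \<noteq> 0} u x" "{v. u v \<noteq> 0} \<subseteq> V" "{v. u v \<noteq> 0} \<noteq> {}"
proof -
  show V: "{v. u v \<noteq> 0} \<subseteq> V"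
    using assms(1) by (auto simp: coords_def)
  show "coords {v. u v \<noteq> 0} u x"
    using coords_mono[OF assms(1) subset_refl assms(2)] V assms(2) finite_subset by blast
  then show "{v. u v \<noteq> 0} \<noteq> {}"
    by (rule coords_nonempty)
qed

lemma affine_on_simplexD:
  assumes "affine_on_simplex V g" "coords V u x"
  shows "g x = (\<Sum>v\<in>V. u v *\<^sub>R g v)"
  using assms unfolding affine_on_simplex_def coords_def by auto

text \<open>In \<open>affine_on_simplex\<close> the weights are arbitrary off \<open>V\<close>;
  cutting them off there turns them into \<open>coords\<close>.\<close>

lemma affine_on_simplexI:
  assumes "\<And>u x. coords V u x \<Longrightarrow> g x = (\<Sum>v\<in>V. u v *\<^sub>R g v)"
  shows "affine_on_simplex V g"
  unfolding affine_on_simplex_def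
proof (intro allI impI)
  fix u :: "'a \<Rightarrow> real" assume u: "(\<forall>v\<in>V. 0 \<le> u v) \<and> sum u V = 1"
  have "coords V (\<lambda>v. if v \<in> V then u v else 0) (\<Sum>v\<in>V. u v *\<^sub>R v)"
    using u unfolding coords_def by (auto cong: sum.cong)
  from assms[OF this] show "g (\<Sum>v\<in>V. u v *\<^sub>R v) = (\<Sum>v\<in>V. u v *\<^sub>R g v)"
    by (auto cong: sum.cong)
qed

lemma affine_on_simplex_linear: "linear g \<Longrightarrow> affine_on_simplex V g"
  by (simp add: affine_on_simplex_def linear_sum linear_scale)

lemma affine_on_simplex_id: "affine_on_simplex V id"
  by (simp add: affine_on_simplex_def)

text \<open>Push-forward of weights: vertices with the same image add their weights, so the formula
  survives a collapsing \<open>g\<close>.\<close>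

lemma coords_image:
  assumes "affine_on_simplex V g" "coords V u x" "finite V"
  shows "coords (g ` V) (\<lambda>w. \<Sum>v | v \<in> V \<and> g v = w. u v) (g x)"
proof -
  have 1: "sum u V = (\<Sum>w\<in>g ` V. \<Sum>v | v \<in> V \<and> g v = w. u v)"
    by (rule sum.image_gen[OF assms(3)])
  have "(\<Sum>v\<in>V. u v *\<^sub>R g v) = (\<Sum>w\<in>g ` V. \<Sum>v | v \<in> V \<and> g v = w. u v *\<^sub>R g v)"
    by (rule sum.image_gen[OF assms(3)])
  also have "\<dots> = (\<Sum>w\<in>g ` V. (\<Sum>v | v \<in> V \<and> g v = w. u v) *\<^sub>R w)"
    by (simp add: scaleR_sum_left)
  finally have 2: "g x = (\<Sum>w\<in>g ` V. (\<Sum>v | v \<in> V \<and> g v = w. u v) *\<^sub>R w)"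
    using affine_on_simplexD[OF assms(1,2)] by simp
  have 3: "(\<Sum>v | v \<in> V \<and> g v = w. u v) = 0" if "w \<notin> g ` V" for w
    using that by (intro sum.neutral) auto
  have "0 \<le> (\<Sum>v | v \<in> V \<and> g v = w. u v)" for w
    by (intro sum_nonneg) (simp add: coords_nonneg[OF assms(2)])
  then show ?thesis
    using 1 2 3 assms(2) unfolding coords_def by metis
qed

lemma coords_image_inj:
  assumes "inj_on g V" "v \<in> V"
  shows "(\<Sum>v' | v' \<in> V \<and> g v' = g v. u v') = u v"
proof -
  have "{v'. v' \<in> V \<and> g v' = g v} = {v}"
    using assms by (auto dest: inj_onD)
  then show ?thesis by simp
qed

lemma coords_in_hull: "coords V u x \<Longrightarrow> finite V \<Longrightarrow> x \<in> convex hull V"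
  using in_convex_hull_iff_coords by blast

lemma affine_image_hull:
  assumes "affine_on_simplex V g" "finite V"
  shows "g ` (convex hull V) = convex hull (g ` V)"
proof
  show "g ` (convex hull V) \<subseteq> convex hull (g ` V)"
    using assms coords_image by (fastforce simp: in_convex_hull_iff_coords)
  show "convex hull (g ` V) \<subseteq> g ` (convex hull V)"
  proof
    fix y assume "y \<in> convex hull (g ` V)"
    then obtain w where w: "coords (g ` V) w y"
      using assms(2) by (auto simp: in_convex_hull_iff_coords)
    \<comment> \<open>One preimage is chosen for each image vertex, and all the weight is put on the
      chosen vertices.\<close>
    define r where "r = inv_into V g"
    have r: "r z \<in> V" "g (r z) = z" if "z \<in> g ` V" for z
      using that by (auto simp: r_def inv_into_into f_inv_into_f)
    define u where "u v = (if v \<in> r ` g ` V then w (g v) else 0)" for v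
    have inj: "inj_on r (g ` V)"
      by (simp add: r_def inj_on_inv_into)
    have sub: "r ` g ` V \<subseteq> V"
      using r by auto
    \<comment> \<open>The target of \<open>h\<close> is left general: the constant 1 gives the total
      weight, and \<open>g\<close> gives the image point.\<close>
    have *: "(\<Sum>v\<in>V. u v *\<^sub>R h v) = (\<Sum>z\<in>g ` V. w z *\<^sub>R h (r z))" for h :: "'a \<Rightarrow> 'c::real_vector"
    proof -
      have "(\<Sum>v\<in>V. u v *\<^sub>R h v) = (\<Sum>v\<in>r ` g ` V. u v *\<^sub>R h v)"
        using sub assms(2) by (intro sum.mono_neutral_right) (auto simp: u_def)
      also have "\<dots> = (\<Sum>z\<in>g ` V. w z *\<^sub>R h (r z))"
        using inj r by (subst sum.reindex) (auto simp: u_def intro!: sum.cong)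
      finally show ?thesis .
    qed
    have "sum u V = 1"
      using *[of "\<lambda>_. 1::real"] w by (simp add: coords_def)
    then have cu: "coords V u (\<Sum>v\<in>V. u v *\<^sub>R v)"
      using w sub by (auto simp: coords_def u_def)
    have "g (\<Sum>v\<in>V. u v *\<^sub>R v) = (\<Sum>v\<in>V. u v *\<^sub>R g v)"
      by (rule affine_on_simplexD[OF assms(1) cu])
    also have "\<dots> = y"
      using *[of g] w r by (simp add: coords_def)
    finally show "y \<in> g ` (convex hull V)"
      using coords_in_hull[OF cu assms(2)] by blast
  qed
qed

text \<open>Mixing the \<open>V\<close>-coordinates of the points of \<open>S\<close> with the
  weights \<open>u\<close> gives \<open>V\<close>-coordinates of \<open>x\<close>, where
  \<open>g\<close> is known to be affine. An infinite \<open>S\<close> admits no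
  \<open>coords\<close>, because its sum of weights would be 0 by convention.\<close>

lemma affine_on_simplex_subset_hull:
  assumes "affine_on_simplex V g" "S \<subseteq> convex hull V" "finite V"
  shows "affine_on_simplex S g"
proof (rule affine_on_simplexI)
  fix u x assume u: "coords S u x"
  have "\<forall>s\<in>S. \<exists>c. coords V c s"
    using assms(2,3) by (auto simp: in_convex_hull_iff_coords)
  then obtain c where c: "\<And>s. s \<in> S \<Longrightarrow> coords V (c s) s"
    by metis
  define w where "w v = (\<Sum>s\<in>S. u s * c s v)" for v
  have *: "(\<Sum>v\<in>V. w v *\<^sub>R h v) = (\<Sum>s\<in>S. u s *\<^sub>R (\<Sum>v\<in>V. c s v *\<^sub>R h v))"
    for h :: "'a \<Rightarrow> 'c::real_vector"
    unfolding w_def scaleR_sum_left scaleR_sum_right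
    by (subst sum.swap) simp
  have "(\<Sum>s\<in>S. u s *\<^sub>R (\<Sum>v\<in>V. c s v *\<^sub>R (1::real))) = (\<Sum>s\<in>S. u s)"
    using c by (intro sum.cong) (auto simp: coords_def)
  then have "sum w V = 1"
    using *[of "\<lambda>_. 1::real"] u by (simp add: coords_def)
  moreover have "(\<Sum>v\<in>V. w v *\<^sub>R v) = x"
    using *[of "\<lambda>v. v"] u c by (simp add: coords_def)
  ultimately have "coords V w x"
    using c u by (auto simp: coords_def w_def intro!: sum_nonneg sum.neutral mult_nonneg_nonneg)
  then have "g x = (\<Sum>v\<in>V. w v *\<^sub>R g v)"
    by (rule affine_on_simplexD[OF assms(1)])
  also have "\<dots> = (\<Sum>s\<in>S. u s *\<^sub>R g s)"
    unfolding * using affine_on_simplexD[OF assms(1) c] by simp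
  finally show "g x = (\<Sum>s\<in>S. u s *\<^sub>R g s)" .
qed

lemma affine_on_simplex_subset: "affine_on_simplex V g \<Longrightarrow> S \<subseteq> V \<Longrightarrow> finite V \<Longrightarrow> affine_on_simplex S g"
  by (meson affine_on_simplex_subset_hull hull_subset subset_trans)

lemma affine_on_simplex_compose:
  assumes "affine_on_simplex V g" "affine_on_simplex (g ` V) h" "finite V"
  shows "affine_on_simplex V (\<lambda>x. h (g x))"
proof (rule affine_on_simplexI)
  fix u x assume u: "coords V u x"
  have "h (g x) = (\<Sum>w\<in>g ` V. (\<Sum>v | v \<in> V \<and> g v = w. u v) *\<^sub>R h w)"
    by (rule affine_on_simplexD[OF assms(2) coords_image[OF assms(1) u assms(3)]])
  also have "\<dots> = (\<Sum>w\<in>g ` V. \<Sum>v | v \<in> V \<and> g v = w. u v *\<^sub>R h (g v))"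
    by (simp add: scaleR_sum_left)
  also have "\<dots> = (\<Sum>v\<in>V. u v *\<^sub>R h (g v))"
    by (rule sum.image_gen[OF assms(3), symmetric])
  finally show "h (g x) = (\<Sum>v\<in>V. u v *\<^sub>R h (g v))" .
qed

text \<open>The positive and the negative part of an affine dependence have the same total weight
  and the same weighted sum. Divided by the total, they are two different coordinate functions of
  one point.\<close>

lemma coords_unique_imp_affine_independent:
  assumes "finite V" and uniq: "\<And>u w x. coords V u x \<Longrightarrow> coords V w x \<Longrightarrow> u = w"
  shows "\<not> affine_dependent V"
proof
  assume "affine_dependent V"
  then obtain U where U: "sum U V = 0" "\<exists>v\<in>V. U v \<noteq> 0" "(\<Sum>v\<in>V. U v *\<^sub>R v) = 0"
    using assms(1) by (auto simp: affine_dependent_explicit_finite)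
  define p where "p v = (if v \<in> V then max (U v) 0 else 0)" for v
  define q where "q v = (if v \<in> V then max (- U v) 0 else 0)" for v
  have pq: "p v - q v = U v" if "v \<in> V" for v
    using that by (auto simp: p_def q_def)
  have "sum p V - sum q V = 0" "(\<Sum>v\<in>V. p v *\<^sub>R v) - (\<Sum>v\<in>V. q v *\<^sub>R v) = 0"
    using U pq by (simp_all add: sum_subtractf[symmetric] scaleR_left_diff_distrib[symmetric])
  then have eq: "sum p V = sum q V" "(\<Sum>v\<in>V. p v *\<^sub>R v) = (\<Sum>v\<in>V. q v *\<^sub>R v)"
    by simp_all
  define s where "s = sum p V"
  have "s \<noteq> 0"
  proof
    assume "s = 0"
    then have "\<forall>v\<in>V. p v = 0" "\<forall>v\<in>V. q v = 0"
      using eq(1) assms(1) by (auto simp: s_def p_def q_def sum_nonneg_eq_0_iff)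
    then show False
      using U(2) pq by force
  qed
  moreover have "s \<ge> 0"
    by (auto simp: s_def p_def intro!: sum_nonneg)
  ultimately have s: "s > 0"
    by simp
  have "\<And>v. p v \<ge> 0" "\<And>v. q v \<ge> 0" "\<And>v. v \<notin> V \<Longrightarrow> p v = 0 \<and> q v = 0"
    by (auto simp: p_def q_def)
  moreover have "(\<Sum>v\<in>V. p v / s) = 1" "(\<Sum>v\<in>V. q v / s) = 1"
    using s eq by (simp_all add: sum_divide_distrib[symmetric] s_def)
  moreover have "(\<Sum>v\<in>V. (p v / s) *\<^sub>R v) = (1 / s) *\<^sub>R (\<Sum>v\<in>V. p v *\<^sub>R v)"
    "(\<Sum>v\<in>V. (q v / s) *\<^sub>R v) = (1 / s) *\<^sub>R (\<Sum>v\<in>V. p v *\<^sub>R v)"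
    by (simp add: scaleR_sum_right) (unfold eq(2), simp add: scaleR_sum_right)
  ultimately have "coords V (\<lambda>v. p v / s) ((1 / s) *\<^sub>R (\<Sum>v\<in>V. p v *\<^sub>R v))"
    "coords V (\<lambda>v. q v / s) ((1 / s) *\<^sub>R (\<Sum>v\<in>V. p v *\<^sub>R v))"
    using s by (auto simp: coords_def)
  then have "(\<lambda>v. p v / s) = (\<lambda>v. q v / s)"
    by (rule uniq)
  then have "\<forall>v. p v = q v"
    using s by (simp add: fun_eq_iff)
  then show False
    using U(2) pq by force
qed

lemma affine_independent_coords_unique:
  assumes "finite V" "\<not> affine_dependent V" "coords V u x" "coords V w x"
  shows "u = w"
proof (rule ccontr)
  assume "u \<noteq> w"
  then obtain v where "u v \<noteq> w v"
    by auto
  moreover from this have "v \<in> V"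
    using assms(3,4) by (metis coords_outside)
  moreover have "(\<Sum>v\<in>V. u v - w v) = 0" "(\<Sum>v\<in>V. (u v - w v) *\<^sub>R v) = 0"
    using assms(3,4) by (auto simp: coords_def sum_subtractf scaleR_left_diff_distrib)
  ultimately show False
    using assms(1,2) unfolding affine_dependent_explicit_finite[OF assms(1)]
    by (metis eq_iff_diff_eq_0)
qed

text \<open>
  Affine independence and the intersection condition together say that barycentric coordinates
  in the whole complex are unique; in this form they are inherited by the constructions below.
\<close>

lemma finite_complex_iff_coords_unique:
  "finite_complex K \<longleftrightarrow>
     finite K \<and> (\<forall>V\<in>K. finite V \<and> V \<noteq> {}) \<and>
     (\<forall>V\<in>K. \<forall>W. W \<subseteq> V \<and> W \<noteq> {} \<longrightarrow> W \<in> K) \<and>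
     (\<forall>V\<in>K. \<forall>W\<in>K. \<forall>u w x. coords V u x \<longrightarrow> coords W w x \<longrightarrow> u = w)"
  (is "_ \<longleftrightarrow> ?fin \<and> ?ne \<and> ?face \<and> ?uniq")
proof
  assume K: "finite_complex K"
  have ?uniq
  proof (intro ballI allI impI)
    fix V W u w x assume VW: "V \<in> K" "W \<in> K" and u: "coords V u x" and w: "coords W w x"
    have fin: "finite V" "finite W" and ind: "\<not> affine_dependent V" "\<not> affine_dependent W"
      using K VW unfolding finite_complex_def by blast+
    have "convex hull V \<inter> convex hull W = convex hull (V \<inter> W)"
      using K VW unfolding finite_complex_def by blast
    then have "x \<in> convex hull (V \<inter> W)"
      using coords_in_hull[OF u fin(1)] coords_in_hull[OF w fin(2)] by blast
    then obtain y where y: "coords (V \<inter> W) y x"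
      using fin by (auto simp: in_convex_hull_iff_coords)
    have "{v. y v \<noteq> 0} \<subseteq> V \<inter> W"
      using fin by (intro coords_support(2)[OF y]) simp
    then have "coords V y x" "coords W y x"
      using fin by (auto intro!: coords_mono[OF y])
    then show "u = w"
      using affine_independent_coords_unique[OF fin(1) ind(1) u]
        affine_independent_coords_unique[OF fin(2) ind(2) w] by blast
  qed
  then show "?fin \<and> ?ne \<and> ?face \<and> ?uniq"
    using K unfolding finite_complex_def by blast
next
  assume K: "?fin \<and> ?ne \<and> ?face \<and> ?uniq"
  note ne = K[THEN conjunct2, THEN conjunct1]
    and uniq = K[THEN conjunct2, THEN conjunct2, THEN conjunct2]
  have "\<not> affine_dependent V" if "V \<in> K" for V
  proof (rule coords_unique_imp_affine_independent)
    show "finite V"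
      using ne that by simp
    show "u = w" if "coords V u x" "coords V w x" for u w x
      using uniq \<open>V \<in> K\<close> that by blast
  qed
  moreover have "convex hull V \<inter> convex hull W = convex hull (V \<inter> W)" if VW: "V \<in> K" "W \<in> K" for V W
  proof
    have fin: "finite V" "finite W"
      using ne VW by auto
    show "convex hull V \<inter> convex hull W \<subseteq> convex hull (V \<inter> W)"
    proof
      fix x assume "x \<in> convex hull V \<inter> convex hull W"
      then obtain u w where uw: "coords V u x" "coords W w x"
        using fin by (auto simp: in_convex_hull_iff_coords)
      then have "u = w"
        using uniq VW by blast
      then have "{v. u v \<noteq> 0} \<subseteq> V \<inter> W"
        using coords_support(2)[OF uw(1) fin(1)] coords_support(2)[OF uw(2) fin(2)] by blast
      then have "coords (V \<inter> W) u x"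
        using fin by (intro coords_mono[OF uw(1)]) auto
      then show "x \<in> convex hull (V \<inter> W)"
        using fin by (auto intro: coords_in_hull)
    qed
    show "convex hull (V \<inter> W) \<subseteq> convex hull V \<inter> convex hull W"
      by (simp add: hull_mono)
  qed
  ultimately show "finite_complex K"
    using K unfolding finite_complex_def by meson
qed

context
  fixes K :: "'a::real_vector set set"
  assumes K: "finite_complex K"
begin

lemma finite_complex_finite: "finite K"
  using K unfolding finite_complex_def by blast

lemma simplex_finite: "V \<in> K \<Longrightarrow> finite V"
  using K unfolding finite_complex_def by blast

lemma simplex_nonempty: "V \<in> K \<Longrightarrow> V \<noteq> {}"
  using K unfolding finite_complex_def by blast

lemma simplex_face: "V \<in> K \<Longrightarrow> W \<subseteq> V \<Longrightarrow> W \<noteq> {} \<Longrightarrow> W \<in> K"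
  using K unfolding finite_complex_def by blast

lemma simplex_coords_unique:
  "V \<in> K \<Longrightarrow> W \<in> K \<Longrightarrow> coords V u x \<Longrightarrow> coords W w x \<Longrightarrow> u = w"
  using K[unfolded finite_complex_iff_coords_unique, THEN conjunct2, THEN conjunct2, THEN conjunct2]
  by blast

lemma simplex_support:
  assumes "V \<in> K" "coords V u x"
  shows "{v. u v \<noteq> 0} \<in> K"
  by (rule simplex_face[OF assms(1)])
    (rule coords_support[OF assms(2) simplex_finite[OF assms(1)]])+

lemma underlying_coords: "x \<in> underlying K \<longleftrightarrow> (\<exists>V\<in>K. \<exists>u. coords V u x)"
  unfolding underlying_def UN_iff using simplex_finite in_convex_hull_iff_coords
  by (intro bex_cong refl) blast

text \<open>The support of any coordinates of \<open>x\<close> is the carrier of \<open>x\<close>,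
  the simplex whose relative interior contains it.\<close>

lemma underlying_positive_coords:
  assumes "x \<in> underlying K"
  obtains V u where "V \<in> K" "coords V u x" "\<And>v. v \<in> V \<Longrightarrow> 0 < u v"
proof -
  from assms obtain V u where V: "V \<in> K" "coords V u x"
    unfolding underlying_coords by blast
  show thesis
  proof (rule that)
    show "{v. u v \<noteq> 0} \<in> K" "coords {v. u v \<noteq> 0} u x"
      using simplex_support[OF V] coords_support[OF V(2) simplex_finite[OF V(1)]] by auto
    show "\<And>v. v \<in> {v. u v \<noteq> 0} \<Longrightarrow> 0 < u v"
      using coords_nonneg[OF V(2)] by (auto simp: order_less_le)
  qed
qed

end

text \<open>Equal images have equal pushed-forward weights, and over an injective vertex map each
  fibre sum is a single coefficient.\<close>

lemma affine_inj_on_hull: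
  assumes "affine_on_simplex V g" "inj_on g V" "finite V" "\<not> affine_dependent (g ` V)"
  shows "inj_on g (convex hull V)"
proof (rule inj_onI)
  fix x y assume "x \<in> convex hull V" "y \<in> convex hull V" and eq: "g x = g y"
  then obtain u w where u: "coords V u x" and w: "coords V w y"
    using assms(3) by (auto simp: in_convex_hull_iff_coords)
  have "(\<lambda>z. \<Sum>v | v \<in> V \<and> g v = z. u v) = (\<lambda>z. \<Sum>v | v \<in> V \<and> g v = z. w v)"
    using affine_independent_coords_unique[OF _ assms(4) coords_image[OF assms(1) u assms(3)]]
      coords_image[OF assms(1) w assms(3)] eq assms(3) by simp
  then have "u v = w v" if "v \<in> V" for v
    using coords_image_inj[OF assms(2) that] by metis
  then have "(\<Sum>v\<in>V. u v *\<^sub>R v) = (\<Sum>v\<in>V. w v *\<^sub>R v)"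
    by (intro sum.cong) auto
  then show "x = y"
    using u w by (simp add: coords_def)
qed

text \<open>The morphisms for which the pull-back step is functorial: they preserve dimensions.
  Characteristic maps belong to this class as well.\<close>

definition nondegenerate_map ::
  "'a::real_vector set set \<Rightarrow> 'b::real_vector set set \<Rightarrow> ('a \<Rightarrow> 'b) \<Rightarrow> bool" where
  "nondegenerate_map K K' h \<longleftrightarrow> simplicial_map K K' h \<and> (\<forall>V\<in>K. inj_on h V)"

lemma nondegenerate_mapD:
  assumes "nondegenerate_map K K' h" "V \<in> K"
  shows "h ` V \<in> K'" "affine_on_simplex V h" "inj_on h V"
  using assms by (auto simp: nondegenerate_map_def simplicial_map_def)

lemma nondegenerate_map_inj_on_hull:
  assumes "nondegenerate_map K K' h" "V \<in> K" "finite_complex K" "finite_complex K'"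
  shows "inj_on h (convex hull V)"
proof (rule affine_inj_on_hull)
  show "affine_on_simplex V h" "inj_on h V"
    using nondegenerate_mapD[OF assms(1,2)] by simp_all
  show "finite V"
    by (rule simplex_finite[OF assms(3,2)])
  show "\<not> affine_dependent (h ` V)"
    using nondegenerate_mapD(1)[OF assms(1,2)] assms(4) unfolding finite_complex_def by blast
qed

lemma simplicial_map_underlying:
  assumes "simplicial_map K K' h" "finite_complex K" "x \<in> underlying K"
  shows "h x \<in> underlying K'"
proof -
  obtain V where V: "V \<in> K" "x \<in> convex hull V"
    using assms(3) by (auto simp: underlying_def)
  then have "h x \<in> convex hull (h ` V)"
    using assms(1,2) affine_image_hull[of V h] by (auto simp: simplicial_map_def simplex_finite)
  then show ?thesis
    using assms(1) V(1) by (auto simp: simplicial_map_def underlying_def)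
qed

section \<open>Barycentric subdivision and its characteristic map\<close>

lemma chain_subset_Union_mem:
  assumes "finite C" "C \<noteq> {}" "chain_subset C"
  shows "\<Union>C \<in> C"
  using assms
proof (induction C rule: finite_ne_induct)
  case (insert V C)
  then have "\<Union>C \<in> C" "V \<subseteq> \<Union>C \<or> \<Union>C \<subseteq> V"
    unfolding chain_subset_def by blast+
  then show ?case
    by (auto simp: subset_Un_eq Un_absorb2)
qed simp

text \<open>Layer-cake formula: each member of a flag is a layer of height \<open>a V\<close> spread
  over its vertices. Such sums express a point of the barycentric subdivision in the coordinates of
  the original complex.\<close>

definition chain_sum :: "'a set set \<Rightarrow> ('a set \<Rightarrow> real) \<Rightarrow> 'a \<Rightarrow> real" where
  "chain_sum C a v = (\<Sum>V | V \<in> C \<and> v \<in> V. a V)"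

lemma chain_sum_remove:
  assumes "finite C" "T \<in> C"
  shows "chain_sum (C - {T}) a v = chain_sum C a v - (if v \<in> T then a T else 0)"
proof (cases "v \<in> T")
  case True
  then have eq: "{V. V \<in> C \<and> v \<in> V} = insert T {V. V \<in> C - {T} \<and> v \<in> V}"
    using assms(2) by auto
  show ?thesis
    unfolding chain_sum_def eq using True assms(1) by (subst sum.insert) auto
next
  case False
  then have "{V. V \<in> C - {T} \<and> v \<in> V} = {V. V \<in> C \<and> v \<in> V}"
    by auto
  then show ?thesis
    using False by (simp add: chain_sum_def)
qed

lemma chain_sum_support:
  assumes "finite C" "\<And>V. V \<in> C \<Longrightarrow> 0 < a V"
  shows "{v. chain_sum C a v \<noteq> 0} = \<Union>C"
proof -
  have "chain_sum C a v = 0 \<longleftrightarrow> v \<notin> \<Union>C" for v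
    unfolding chain_sum_def
    using assms by (subst sum_nonneg_eq_0_iff) (auto simp: less_imp_le less_imp_neq[symmetric] dest: assms(2))
  then show ?thesis by auto
qed

text \<open>The top member contains a vertex outside all the others, where the sum is its coefficient.\<close>

lemma chain_sum_top_le:
  assumes C: "finite C" "C \<noteq> {}" "chain_subset C" "{} \<notin> C" "\<And>V. V \<in> C \<Longrightarrow> 0 < a V"
    and D: "finite D" "\<And>V. V \<in> D \<Longrightarrow> 0 < b V" "\<Union>C \<in> D"
    and eq: "\<And>v. chain_sum C a v = chain_sum D b v"
  shows "b (\<Union>C) \<le> a (\<Union>C)"
proof -
  let ?T = "\<Union>C"
  have T: "?T \<in> C"
    by (rule chain_subset_Union_mem[OF C(1-3)])
  have "\<exists>v\<in>?T. v \<notin> \<Union>(C - {?T})"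
  proof (cases "C - {?T} = {}")
    case True
    then show ?thesis
      using T C(4) by (metis Sup_empty all_not_in_conv)
  next
    case False
    have "\<Union>(C - {?T}) \<in> C - {?T}"
      using C(1,3) False by (intro chain_subset_Union_mem) (auto simp: chain_subset_def)
    then show ?thesis
      by blast
  qed
  then obtain v where v: "v \<in> ?T" "v \<notin> \<Union>(C - {?T})"
    by blast
  then have "chain_sum (C - {?T}) a v = 0"
    unfolding chain_sum_def by (intro sum.neutral) blast
  then have "a ?T = chain_sum D b v"
    using chain_sum_remove[OF C(1) T, of a v] v eq by simp
  also have "\<dots> \<ge> b ?T"
    unfolding chain_sum_def using D v by (intro member_le_sum) (auto simp: less_imp_le)
  finally show ?thesis .
qed

text \<open>The support of the sum is the top member, so the tops agree;
  \<open>chain_sum_top_le\<close> in both directions makes their heights agree. Removing the common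
  top layer leaves equal sums over shorter flags.\<close>

lemma chain_sum_unique:
  assumes "finite C" "chain_subset C" "{} \<notin> C" "\<And>V. V \<in> C \<Longrightarrow> 0 < a V"
    and "finite D" "chain_subset D" "{} \<notin> D" "\<And>V. V \<in> D \<Longrightarrow> 0 < b V"
    and "\<And>v. chain_sum C a v = chain_sum D b v"
  shows "C = D \<and> (\<forall>V\<in>C. a V = b V)"
  using assms
proof (induction "card C" arbitrary: C D)
  case 0
  then have "C = {}"
    by simp
  moreover have "\<Union>C = \<Union>D"
    using chain_sum_support[of C a] chain_sum_support[of D b] 0 by simp
  ultimately show ?case
    using 0(8) by auto
next
  case (Suc n)
  let ?T = "\<Union>C"
  have U: "\<Union>C = \<Union>D"
    using chain_sum_support[of C a] chain_sum_support[of D b] Suc by simp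
  have ne: "C \<noteq> {}"
    using Suc(2) by auto
  then have "D \<noteq> {}"
    using U Suc.prems(3) by auto
  then have T: "?T \<in> C" "?T \<in> D"
    using chain_subset_Union_mem[of C] chain_subset_Union_mem[of D] ne U Suc.prems by simp_all
  have "b ?T \<le> a ?T"
    using Suc.prems ne T by (intro chain_sum_top_le[of C a D b]) simp_all
  moreover have "a ?T \<le> b ?T"
    using Suc.prems \<open>D \<noteq> {}\<close> T unfolding U
    by (intro chain_sum_top_le[of D b C a]) simp_all
  ultimately have ab: "a ?T = b ?T"
    by simp
  have "C - {?T} = D - {?T} \<and> (\<forall>V\<in>C - {?T}. a V = b V)"
  proof (rule Suc.hyps(1))
    show "n = card (C - {?T})"
      using Suc.hyps(2) Suc.prems(1) T by simp
    show "chain_sum (C - {?T}) a v = chain_sum (D - {?T}) b v" for v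
      using Suc.prems T ab by (simp only: chain_sum_remove)
  qed (use Suc.prems in \<open>auto simp: chain_subset_def\<close>)
  then show ?case
    using T ab by blast
qed

text \<open>The whole support becomes the top member, with the least positive value as its height.
  Subtracting this layer kills at least one vertex, so the rest has a strictly smaller support,
  which contains all further members.\<close>

lemma chain_sum_exists:
  fixes u :: "'a \<Rightarrow> real"
  assumes "finite {v. u v \<noteq> 0}" "\<And>v. 0 \<le> u v"
  shows "\<exists>C a. C \<subseteq> Pow {v. u v \<noteq> 0} \<and> chain_subset C \<and> {} \<notin> C \<and> (\<forall>V\<in>C. 0 < a V) \<and>
           (\<forall>v. chain_sum C a v = u v)"
  using assms
proof (induction "card {v. u v \<noteq> 0}" arbitrary: u rule: less_induct)
  case less
  let ?S = "{v. u v \<noteq> 0}"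
  show ?case
  proof (cases "?S = {}")
    case True
    then show ?thesis
      by (intro exI[of _ "{}"]) (auto simp: chain_sum_def chain_subset_def)
  next
    case False
    define m where "m = Min (u ` ?S)"
    have "m \<in> u ` ?S"
      unfolding m_def using False less.prems(1) by (intro Min_in) auto
    then obtain s where s: "s \<in> ?S" "u s = m"
      by auto
    have m: "0 < m" "\<And>v. v \<in> ?S \<Longrightarrow> m \<le> u v"
      using s less.prems(2)[of s] less.prems(1) by (auto simp: m_def order_less_le)
    define u' where "u' v = (if v \<in> ?S then u v - m else 0)" for v
    have sub: "{v. u' v \<noteq> 0} \<subset> ?S"
      using s by (auto simp: u'_def)
    have "\<exists>C a. C \<subseteq> Pow {v. u' v \<noteq> 0} \<and> chain_subset C \<and> {} \<notin> C \<and> (\<forall>V\<in>C. 0 < a V) \<and>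
           (\<forall>v. chain_sum C a v = u' v)"
    proof (rule less.hyps)
      show "card {v. u' v \<noteq> 0} < card ?S"
        using sub less.prems(1) by (rule psubset_card_mono[rotated])
      show "finite {v. u' v \<noteq> 0}"
        using sub less.prems(1) finite_subset by blast
      show "0 \<le> u' v" for v
        using m(2) by (simp add: u'_def)
    qed
    then obtain C a where C: "C \<subseteq> Pow {v. u' v \<noteq> 0}" "chain_subset C" "{} \<notin> C"
        "\<forall>V\<in>C. 0 < a V" "\<And>v. chain_sum C a v = u' v"
      by blast
    have "?S \<notin> C"
      using C(1) sub by blast
    have fin: "finite C"
      using C(1) sub less.prems(1) by (meson finite_Pow_iff finite_subset psubset_imp_subset)
    define a' where "a' = a(?S := m)"
    have "chain_sum (insert ?S C) a' v = u v" for v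
    proof -
      have "chain_sum C a' v = chain_sum C a v"
        unfolding chain_sum_def a'_def using \<open>?S \<notin> C\<close> by (intro sum.cong) auto
      moreover have "chain_sum C a' v = chain_sum (insert ?S C) a' v - (if v \<in> ?S then a' ?S else 0)"
        using chain_sum_remove[of "insert ?S C" ?S a' v] fin \<open>?S \<notin> C\<close> by simp
      ultimately show ?thesis
        using C(5)[of v] by (simp add: a'_def u'_def split: if_splits)
    qed
    moreover have "insert ?S C \<subseteq> Pow ?S"
      using C(1) sub by blast
    moreover from this have "chain_subset (insert ?S C)"
      using C(2) unfolding chain_subset_def by blast
    moreover have "{} \<notin> insert ?S C"
      using C(3) False by blast
    moreover have "\<forall>V\<in>insert ?S C. 0 < a' V"
      using C(4) m(1) by (simp add: a'_def)
    ultimately show ?thesis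
      by blast
  qed
qed

text \<open>Exchange of summation. A constant \<open>h\<close> computes the total weight of a
  layer-cake sum, and the identity computes the point it represents.\<close>

lemma sum_chain_sum_scaleR:
  fixes h :: "'a \<Rightarrow> 'b::real_vector"
  assumes "finite C" "finite T" "\<And>V. V \<in> C \<Longrightarrow> V \<subseteq> T"
  shows "(\<Sum>v\<in>T. chain_sum C a v *\<^sub>R h v) = (\<Sum>V\<in>C. a V *\<^sub>R (\<Sum>v\<in>V. h v))"
proof -
  have "(\<Sum>v\<in>T. chain_sum C a v *\<^sub>R h v) = (\<Sum>v\<in>T. \<Sum>V\<in>{V \<in> C. v \<in> V}. a V *\<^sub>R h v)"
    by (simp add: chain_sum_def scaleR_sum_left)
  also have "\<dots> = (\<Sum>V\<in>C. \<Sum>v\<in>{v \<in> T. v \<in> V}. a V *\<^sub>R h v)"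
    using assms by (intro sum.swap_restrict)
  also have "\<dots> = (\<Sum>V\<in>C. a V *\<^sub>R (\<Sum>v\<in>V. h v))"
  proof (intro sum.cong refl)
    fix V assume "V \<in> C"
    then have "{v \<in> T. v \<in> V} = V"
      using assms(3) by auto
    then show "(\<Sum>v\<in>{v \<in> T. v \<in> V}. a V *\<^sub>R h v) = a V *\<^sub>R (\<Sum>v\<in>V. h v)"
      by (simp add: scaleR_sum_right)
  qed
  finally show ?thesis .
qed

section \<open>Barycenters and the subdivided complex\<close>

lemma coords_barycenter:
  assumes "finite V" "V \<noteq> {}"
  shows "coords V (\<lambda>v. if v \<in> V then 1 / real (card V) else 0) (barycenter V)"
  using assms by (auto simp: coords_def barycenter_def scaleR_sum_right)

lemma coords_barycenter_chain_sum:
  assumes "finite V" "V \<noteq> {}"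
  shows "coords V (chain_sum {V} (\<lambda>_. 1 / real (card V))) (barycenter V)"
proof -
  have "chain_sum {V} (\<lambda>_. 1 / real (card V)) = (\<lambda>v. if v \<in> V then 1 / real (card V) else 0)"
    by (auto simp: chain_sum_def fun_eq_iff Collect_conv_if2 conj_commute cong: conj_cong)
  then show ?thesis
    using coords_barycenter[OF assms] by simp
qed

lemma barycenter_in_hull: "finite V \<Longrightarrow> V \<noteq> {} \<Longrightarrow> barycenter V \<in> convex hull V"
  by (rule coords_in_hull[OF coords_barycenter])

text \<open>A barycenter is the layer-cake sum of a flag with one member, so uniqueness of flags
  recovers the simplex. This gives meaning to \<open>inv_into K barycenter\<close> in
  \<open>barycentric_char\<close>.\<close>

lemma inj_on_barycenter:
  assumes "finite_complex K"
  shows "inj_on barycenter K"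
proof (rule inj_onI)
  fix V W assume VW: "V \<in> K" "W \<in> K" and eq: "barycenter V = barycenter W"
  have V: "finite V" "V \<noteq> {}" and W: "finite W" "W \<noteq> {}"
    using VW assms simplex_finite simplex_nonempty by blast+
  have "chain_sum {V} (\<lambda>_. 1 / real (card V)) = chain_sum {W} (\<lambda>_. 1 / real (card W))"
    using simplex_coords_unique[OF assms VW coords_barycenter_chain_sum[OF V]]
      coords_barycenter_chain_sum[OF W] eq by simp
  then have "{V} = {W} \<and> (\<forall>U\<in>{V}. 1 / real (card V) = 1 / real (card W))"
    using V W by (intro chain_sum_unique) (auto simp: chain_subset_def card_gt_0_iff)
  then show "V = W"
    by simp
qed

lemma in_barycentric_subdivision:
  "B \<in> barycentric_subdivision K \<longleftrightarrow>
     (\<exists>C. B = barycenter ` C \<and> C \<subseteq> K \<and> C \<noteq> {} \<and> chain_subset C)"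
  unfolding barycentric_subdivision_def chain_subset_def by auto

context
  fixes K :: "'a::real_vector set set"
  assumes K: "finite_complex K"
begin

lemma chain_finite: "C \<subseteq> K \<Longrightarrow> finite C"
  using finite_complex_finite[OF K] finite_subset by blast

lemma chain_Union_mem:
  assumes "C \<subseteq> K" "C \<noteq> {}" "chain_subset C"
  shows "\<Union>C \<in> K"
  using chain_subset_Union_mem[OF chain_finite assms(2,3)] assms(1) by blast

lemma barycenters_subset_hull:
  assumes "C \<subseteq> K" "C \<noteq> {}" "chain_subset C"
  shows "barycenter ` C \<subseteq> convex hull (\<Union>C)"
proof
  fix b assume "b \<in> barycenter ` C"
  then obtain V where V: "V \<in> C" "b = barycenter V"
    by blast
  then have "b \<in> convex hull V"
    using barycenter_in_hull[of V] simplex_finite[OF K] simplex_nonempty[OF K] assms(1) by blast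
  then show "b \<in> convex hull (\<Union>C)"
    using hull_mono[of V "\<Union>C"] V(1) by blast
qed

text \<open>A barycenter shares its weight equally among its vertices; dividing by their number
  turns the weight \<open>t V\<close> into the height of a layer.\<close>

lemma coords_chain_sum:
  assumes C: "C \<subseteq> K" "C \<noteq> {}" "chain_subset C"
    and t: "\<And>V. V \<in> C \<Longrightarrow> 0 \<le> t V" "sum t C = 1"
  shows "coords (\<Union>C) (chain_sum C (\<lambda>V. t V / real (card V))) (\<Sum>V\<in>C. t V *\<^sub>R barycenter V)"
proof -
  let ?a = "\<lambda>V. t V / real (card V)"
  have fin: "finite C" "finite (\<Union>C)"
    using chain_finite[OF C(1)] simplex_finite[OF K] chain_Union_mem[OF C] by blast+
  have card: "real (card V) \<noteq> 0" if "V \<in> C" for V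
    using that C(1) simplex_finite[OF K] simplex_nonempty[OF K] by (simp add: subset_iff)
  have "(\<Sum>v\<in>\<Union>C. chain_sum C ?a v *\<^sub>R (1::real)) = (\<Sum>V\<in>C. ?a V *\<^sub>R (\<Sum>v\<in>V. 1))"
    by (rule sum_chain_sum_scaleR[OF fin]) auto
  also have "\<dots> = (\<Sum>V\<in>C. t V)"
    using card by (intro sum.cong) auto
  finally have "sum (chain_sum C ?a) (\<Union>C) = 1"
    using t(2) by simp
  moreover have "(\<Sum>v\<in>\<Union>C. chain_sum C ?a v *\<^sub>R v) = (\<Sum>V\<in>C. ?a V *\<^sub>R (\<Sum>v\<in>V. v))"
    by (rule sum_chain_sum_scaleR[OF fin]) auto
  moreover have "\<dots> = (\<Sum>V\<in>C. t V *\<^sub>R barycenter V)"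
    by (simp add: barycenter_def)
  moreover have "0 \<le> chain_sum C ?a v" for v
    unfolding chain_sum_def using t(1) by (intro sum_nonneg) simp
  moreover have "chain_sum C ?a v = 0" if "v \<notin> \<Union>C" for v
    unfolding chain_sum_def using that by (intro sum.neutral) blast
  ultimately show ?thesis
    by (simp add: coords_def)
qed

lemma coords_barycenters_imp_chain_sum:
  assumes C: "C \<subseteq> K" "C \<noteq> {}" "chain_subset C" and u: "coords (barycenter ` C) u x"
  shows "coords (\<Union>C) (chain_sum C (\<lambda>V. u (barycenter V) / real (card V))) x"
proof -
  have inj: "inj_on barycenter C"
    using inj_on_subset[OF inj_on_barycenter[OF K] C(1)] .
  have "sum (\<lambda>V. u (barycenter V)) C = 1" "(\<Sum>V\<in>C. u (barycenter V) *\<^sub>R barycenter V) = x"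
    using u by (simp_all add: coords_def sum.reindex[OF inj] o_def)
  then show ?thesis
    using coords_chain_sum[OF C, of "\<lambda>V. u (barycenter V)"] coords_nonneg[OF u] by simp
qed

text \<open>Both representations become layer-cake sums in the coordinates of \<open>K\<close>,
  where coordinates are unique; then \<open>chain_sum_unique\<close> compares the flags and the
  heights.\<close>

lemma barycentric_coords_unique:
  assumes C: "C \<subseteq> K" "chain_subset C" and u: "coords (barycenter ` C) u x"
    and D: "D \<subseteq> K" "chain_subset D" and w: "coords (barycenter ` D) w x"
  shows "u = w"
proof -
  \<comment> \<open>Members of weight zero leave no trace in the sum, so the flags can agree only
    after these are discarded.\<close>
  define pos where "pos E (r :: 'a \<Rightarrow> real) = {V \<in> E. r (barycenter V) \<noteq> 0}" for E r
  have *: "pos E r \<subseteq> K" "chain_subset (pos E r)" "{} \<notin> pos E r" "finite (pos E r)"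
      "{b. r b \<noteq> 0} = barycenter ` pos E r"
      "\<forall>V\<in>pos E r. 0 < r (barycenter V) / real (card V)"
      "coords (\<Union>(pos E r)) (chain_sum (pos E r) (\<lambda>V. r (barycenter V) / real (card V))) x"
      "pos E r \<noteq> {}"
    if E: "E \<subseteq> K" "chain_subset E" and r: "coords (barycenter ` E) r x" for E r
  proof -
    show sub: "pos E r \<subseteq> K" and ch: "chain_subset (pos E r)"
      using E unfolding pos_def chain_subset_def by blast+
    then show "{} \<notin> pos E r" "finite (pos E r)"
      using simplex_nonempty[OF K] chain_finite by blast+
    show eq: "{b. r b \<noteq> 0} = barycenter ` pos E r"
    proof (intro set_eqI iffI)
      fix b assume b: "b \<in> {b. r b \<noteq> 0}"
      then have "b \<in> barycenter ` E"
        using coords_outside[OF r] by blast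
      then show "b \<in> barycenter ` pos E r"
        using b by (auto simp: pos_def)
    qed (auto simp: pos_def)
    have fin: "finite (barycenter ` E)"
      using chain_finite[OF E(1)] by blast
    then have r': "coords (barycenter ` pos E r) r x"
      using coords_support(1)[OF r] eq by simp
    then show ne: "pos E r \<noteq> {}"
      using coords_nonempty by blast
    show "\<forall>V\<in>pos E r. 0 < r (barycenter V) / real (card V)"
    proof
      fix V assume V: "V \<in> pos E r"
      then have "0 < card V"
        using sub simplex_finite[OF K] simplex_nonempty[OF K] by (auto simp: card_gt_0_iff)
      moreover have "0 < r (barycenter V)"
        using V coords_nonneg[OF r] by (simp add: pos_def order_less_le)
      ultimately show "0 < r (barycenter V) / real (card V)"
        by simp
    qed
    show "coords (\<Union>(pos E r)) (chain_sum (pos E r) (\<lambda>V. r (barycenter V) / real (card V))) x"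
      by (rule coords_barycenters_imp_chain_sum[OF sub ne ch r'])
  qed
  note Cu = *[OF C u] and Dw = *[OF D w]
  have "chain_sum (pos C u) (\<lambda>V. u (barycenter V) / real (card V)) =
      chain_sum (pos D w) (\<lambda>V. w (barycenter V) / real (card V))"
    by (rule simplex_coords_unique[OF K chain_Union_mem[OF Cu(1,8,2)] chain_Union_mem[OF Dw(1,8,2)]
          Cu(7) Dw(7)])
  then have eq: "pos C u = pos D w \<and>
      (\<forall>V\<in>pos C u. u (barycenter V) / real (card V) = w (barycenter V) / real (card V))"
    using Cu(6) Dw(6) by (intro chain_sum_unique Cu(2-4) Dw(2-4)) (blast, blast, metis)
  show "u = w"
  proof
    fix b
    show "u b = w b"
    proof (cases "u b = 0")
      case True
      then have "b \<notin> {b. w b \<noteq> 0}"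
        using Cu(5) Dw(5) eq by blast
      then show ?thesis
        using True by simp
    next
      case False
      then obtain V where V: "V \<in> pos C u" "b = barycenter V"
        using Cu(5) by blast
      \<comment> \<open>Equal heights yield equal weights only after cancelling
        \<open>card V\<close>; positivity of the height excludes the value 0, for which the quotient
        would be 0.\<close>
      then have "card V \<noteq> 0"
        using bspec[OF Cu(6), of V] by (cases "card V = 0") auto
      then show ?thesis
        using eq V by (metis divide_cancel_right of_nat_eq_0_iff)
    qed
  qed
qed

lemma finite_complex_barycentric_subdivision: "finite_complex (barycentric_subdivision K)"
  unfolding finite_complex_iff_coords_unique
proof (intro conjI)
  have "barycentric_subdivision K \<subseteq> (\<lambda>C. barycenter ` C) ` Pow K"
    by (auto simp: in_barycentric_subdivision)
  then show "finite (barycentric_subdivision K)"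
    using finite_complex_finite[OF K] finite_subset by blast
  show "\<forall>B\<in>barycentric_subdivision K. finite B \<and> B \<noteq> {}"
    using chain_finite by (auto simp: in_barycentric_subdivision)
  show "\<forall>B\<in>barycentric_subdivision K. \<forall>W. W \<subseteq> B \<and> W \<noteq> {} \<longrightarrow> W \<in> barycentric_subdivision K"
  proof (intro ballI allI impI)
    fix B W assume "B \<in> barycentric_subdivision K" and W: "W \<subseteq> B \<and> W \<noteq> {}"
    then obtain C where C: "B = barycenter ` C" "C \<subseteq> K" "chain_subset C"
      by (auto simp: in_barycentric_subdivision)
    obtain D where D: "D \<subseteq> C" "W = barycenter ` D"
      using W C(1) by (auto simp: subset_image_iff)
    then have "D \<subseteq> K" "D \<noteq> {}" "chain_subset D"
      using C W unfolding chain_subset_def by blast+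
    then show "W \<in> barycentric_subdivision K"
      using D(2) unfolding in_barycentric_subdivision by blast
  qed
  show "\<forall>V\<in>barycentric_subdivision K. \<forall>W\<in>barycentric_subdivision K.
      \<forall>u w x. coords V u x \<longrightarrow> coords W w x \<longrightarrow> u = w"
  proof (intro ballI allI impI)
    fix V W u w x assume "V \<in> barycentric_subdivision K" "W \<in> barycentric_subdivision K"
      and uw: "coords V u x" "coords W w x"
    then obtain C D where "V = barycenter ` C" "C \<subseteq> K" "chain_subset C"
        "W = barycenter ` D" "D \<subseteq> K" "chain_subset D"
      unfolding in_barycentric_subdivision by blast
    then show "u = w"
      using barycentric_coords_unique uw by blast
  qed
qed

lemma barycentric_subdivision_hull_subset:
  assumes "B \<in> barycentric_subdivision K"
  shows "\<exists>V\<in>K. convex hull B \<subseteq> convex hull V"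
proof -
  obtain C where C: "B = barycenter ` C" "C \<subseteq> K" "C \<noteq> {}" "chain_subset C"
    using assms by (auto simp: in_barycentric_subdivision)
  have "convex hull B \<subseteq> convex hull (\<Union>C)"
    using barycenters_subset_hull[OF C(2-4)] C(1) by (simp add: subset_hull)
  then show ?thesis
    using chain_Union_mem[OF C(2-4)] by blast
qed

text \<open>For the harder inclusion, the coordinates of a point are peeled into layers; the members
  of the resulting flag are faces of the carrier of the point.\<close>

lemma underlying_barycentric_subdivision: "underlying (barycentric_subdivision K) = underlying K"
proof
  show "underlying (barycentric_subdivision K) \<subseteq> underlying K"
    using barycentric_subdivision_hull_subset unfolding underlying_def by blast
  show "underlying K \<subseteq> underlying (barycentric_subdivision K)"
  proof
    fix x assume "x \<in> underlying K"
    then obtain V u where V: "V \<in> K" "coords V u x" 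
      by (auto simp: underlying_coords[OF K])
    let ?S = "{v. u v \<noteq> 0}"
    have S: "coords ?S u x" "?S \<in> K" "finite ?S"
      using coords_support(1)[OF V(2)] simplex_support[OF K V] simplex_finite[OF K] V(1) by blast+
    obtain C a where C: "C \<subseteq> Pow ?S" "chain_subset C" "{} \<notin> C" "\<forall>V\<in>C. 0 < a V"
        "\<And>v. chain_sum C a v = u v"
      using chain_sum_exists[OF S(3)] coords_nonneg[OF V(2)] by blast
    have CK: "C \<subseteq> K"
    proof
      fix W assume W: "W \<in> C"
      then have "W \<noteq> {}" "W \<subseteq> ?S"
        using C(1,3) by blast+
      then show "W \<in> K"
        using simplex_face[OF K S(2)] by blast
    qed
    have ne: "C \<noteq> {}"
    proof
      assume "C = {}"
      then have "\<And>v. u v = 0"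
        using C(5) by (simp add: chain_sum_def)
      then show False
        using coords_nonempty[OF S(1)] by blast
    qed
    have fin: "finite C"
      using chain_finite[OF CK] .
    have card: "0 < real (card W)" if "W \<in> C" for W
      using that CK simplex_finite[OF K] simplex_nonempty[OF K] by (auto simp: card_gt_0_iff)
    \<comment> \<open>A layer of height \<open>a V\<close> has mass \<open>a V\<close> at each of
      \<open>card V\<close> vertices; this product is the weight of the barycenter.\<close>
    let ?t = "\<lambda>V. a V * real (card V)"
    have "(\<Sum>v\<in>?S. chain_sum C a v *\<^sub>R (1::real)) = (\<Sum>V\<in>C. a V *\<^sub>R (\<Sum>v\<in>V. 1))"
      using C(1) by (intro sum_chain_sum_scaleR[OF fin S(3)]) blast
    then have t1: "sum ?t C = 1"
      using S(1) by (simp add: C(5) coords_def)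
    have "(\<Sum>v\<in>?S. chain_sum C a v *\<^sub>R v) = (\<Sum>V\<in>C. a V *\<^sub>R (\<Sum>v\<in>V. v))"
      using C(1) by (intro sum_chain_sum_scaleR[OF fin S(3)]) blast
    also have "\<dots> = (\<Sum>V\<in>C. ?t V *\<^sub>R barycenter V)"
      using card by (intro sum.cong) (auto simp: barycenter_def)
    finally have x: "(\<Sum>V\<in>C. ?t V *\<^sub>R barycenter V) = x"
      using S(1) by (simp add: C(5) coords_def)
    have "(\<Sum>V\<in>C. ?t V *\<^sub>R barycenter V) \<in> convex hull (barycenter ` C)"
      using t1 C(4) fin by (intro convex_sum) (auto simp: hull_inc less_imp_le)
    moreover have "barycenter ` C \<in> barycentric_subdivision K"
      using CK ne C(2) unfolding in_barycentric_subdivision by blast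
    ultimately show "x \<in> underlying (barycentric_subdivision K)"
      unfolding x underlying_def by blast
  qed
qed

text \<open>The definite description is justified by uniqueness of coordinates across the whole
  complex: any two admissible representations of \<open>x\<close> have the same support and the same
  weights on it.\<close>

lemma simplicial_extension_eq:
  assumes "V \<in> K" "coords V u x"
  shows "simplicial_extension K g x = (\<Sum>v\<in>V. u v *\<^sub>R g v)"
  unfolding simplicial_extension_def
proof (rule the_equality)
  show "\<exists>W\<in>K. \<exists>w. (\<forall>v\<in>W. 0 \<le> w v) \<and> sum w W = 1 \<and> x = (\<Sum>v\<in>W. w v *\<^sub>R v) \<and>
      (\<Sum>v\<in>V. u v *\<^sub>R g v) = (\<Sum>v\<in>W. w v *\<^sub>R g v)"
    using assms unfolding coords_def by blast
next
  fix y assume "\<exists>V\<in>K. \<exists>u. (\<forall>v\<in>V. 0 \<le> u v) \<and> sum u V = 1 \<and> x = (\<Sum>v\<in>V. u v *\<^sub>R v) \<and>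
      y = (\<Sum>v\<in>V. u v *\<^sub>R g v)"
  then obtain W w where W: "W \<in> K" "\<forall>v\<in>W. 0 \<le> w v" "sum w W = 1" "x = (\<Sum>v\<in>W. w v *\<^sub>R v)"
      "y = (\<Sum>v\<in>W. w v *\<^sub>R g v)"
    by blast
  \<comment> \<open>The description says nothing about the weights off \<open>W\<close>; they are
    set to zero to make uniqueness applicable.\<close>
  define w' where "w' v = (if v \<in> W then w v else 0)" for v
  have w': "coords W w' x"
    using W unfolding coords_def w'_def by (auto cong: sum.cong)
  have eq: "u = w'"
    by (rule simplex_coords_unique[OF K assms(1) W(1) assms(2) w'])
  have fin: "finite V" "finite W"
    using assms(1) W(1) simplex_finite[OF K] by blast+
  have "y = (\<Sum>v\<in>W. w' v *\<^sub>R g v)"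
    using W(5) by (simp add: w'_def cong: sum.cong)
  also have "\<dots> = (\<Sum>v\<in>{v. w' v \<noteq> 0}. w' v *\<^sub>R g v)"
    using coords_support(2)[OF w' fin(2)] fin by (intro sum.mono_neutral_right) auto
  also have "\<dots> = (\<Sum>v\<in>V. w' v *\<^sub>R g v)"
    using coords_support(2)[OF assms(2) fin(1)] fin unfolding eq
    by (intro sum.mono_neutral_left) auto
  finally show "y = (\<Sum>v\<in>V. u v *\<^sub>R g v)"
    using eq by simp
qed

lemma simplicial_extension_vertex:
  assumes "V \<in> K" "v \<in> V"
  shows "simplicial_extension K g v = g v"
proof -
  have "{v} \<in> K"
    using simplex_face[OF K assms(1)] assms(2) by blast
  moreover have "coords {v} (\<lambda>w. if w = v then 1 else 0) v"
    by (simp add: coords_def)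
  ultimately have "simplicial_extension K g v = (\<Sum>w\<in>{v}. (if w = v then 1 else 0) *\<^sub>R g w)"
    by (rule simplicial_extension_eq)
  then show ?thesis
    by simp
qed

lemma affine_on_simplex_simplicial_extension:
  assumes "V \<in> K"
  shows "affine_on_simplex V (simplicial_extension K g)"
proof (rule affine_on_simplexI)
  fix u x assume "coords V u x"
  from simplicial_extension_eq[OF assms this]
  show "simplicial_extension K g x = (\<Sum>v\<in>V. u v *\<^sub>R simplicial_extension K g v)"
    by (simp add: simplicial_extension_vertex[OF assms] cong: sum.cong)
qed

end

section \<open>The characteristic map of the barycentric subdivision\<close>

lemma barycentric_char_barycenter:
  assumes "finite_complex K" "V \<in> K"
  shows "barycentric_char K (barycenter V) = unit_vertex (card V - 1)"
proof -
  have "barycenter ` {V} \<in> barycentric_subdivision K"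
    unfolding in_barycentric_subdivision using assms(2)
    by (intro exI[of _ "{V}"]) (simp add: chain_subset_def)
  then have "barycentric_char K (barycenter V) =
      unit_vertex (card (inv_into K barycenter (barycenter V)) - 1)"
    unfolding barycentric_char_def
    by (rule simplicial_extension_vertex[OF finite_complex_barycentric_subdivision[OF assms(1)]]) simp
  then show ?thesis
    using inj_on_barycenter[OF assms(1)] assms(2) by simp
qed

lemma inj_unit_vertex: "inj unit_vertex"
proof (rule injI)
  fix i j assume "unit_vertex i = unit_vertex j"
  then have "Poly_Mapping.lookup (unit_vertex i) i = Poly_Mapping.lookup (unit_vertex j) i"
    by simp
  then show "i = j"
    by (simp add: unit_vertex_def lookup_single when_def split: if_splits)
qed

text \<open>Cardinality is strictly increasing along a flag, so its members receive different
  vertices of the standard simplex; the bound on cardinalities keeps the indices at most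
  \<open>n\<close>.\<close>

lemma nondegenerate_barycentric_char:
  assumes K: "finite_complex K" and card: "\<And>V. V \<in> K \<Longrightarrow> card V \<le> n + 1"
  shows "nondegenerate_map (barycentric_subdivision K) (std_simplex n) (barycentric_char K)"
  unfolding nondegenerate_map_def simplicial_map_def
proof (intro conjI ballI)
  fix B assume B: "B \<in> barycentric_subdivision K"
  show "affine_on_simplex B (barycentric_char K)"
    unfolding barycentric_char_def
    by (rule affine_on_simplex_simplicial_extension[OF finite_complex_barycentric_subdivision[OF K] B])
  obtain C where C: "B = barycenter ` C" "C \<subseteq> K" "C \<noteq> {}" "chain_subset C"
    using B by (auto simp: in_barycentric_subdivision)
  have char: "barycentric_char K (barycenter V) = unit_vertex (card V - 1)" if "V \<in> C" for V
    using barycentric_char_barycenter[OF K] that C(2) by blast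
  have "barycentric_char K ` B = (\<lambda>V. unit_vertex (card V - 1)) ` C"
    using C(1) char by (auto simp: image_image)
  moreover have "card V - 1 \<le> n" if "V \<in> C" for V
    using card[of V] that C(2) by auto
  ultimately show "barycentric_char K ` B \<in> std_simplex n"
    using C(3) by (auto simp: std_simplex_def)
  show "inj_on (barycentric_char K) B"
  proof (rule inj_onI)
    fix b b' assume "b \<in> B" "b' \<in> B" and eq: "barycentric_char K b = barycentric_char K b'"
    then obtain V V' where V: "V \<in> C" "b = barycenter V" "V' \<in> C" "b' = barycenter V'"
      using C(1) by blast
    then have fin: "finite V" "finite V'" "V \<noteq> {}" "V' \<noteq> {}"
      using C(2) simplex_finite[OF K] simplex_nonempty[OF K] by blast+
    have "card V - 1 = card V' - 1"
      using eq V char inj_unit_vertex by (simp add: inj_eq)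
    \<comment> \<open>Subtraction is truncated at 0, so nonempty members are needed to recover the
      cardinalities.\<close>
    then have "card V = card V'"
      using fin by (metis One_nat_def Suc_pred card_gt_0_iff)
    then have "V = V'"
      using V fin C(4) card_subset_eq unfolding chain_subset_def by metis
    then show "b = b'"
      using V by simp
  qed
qed

lemma affine_image_barycenter:
  assumes "affine_on_simplex V h" "inj_on h V" "finite V" "V \<noteq> {}"
  shows "h (barycenter V) = barycenter (h ` V)"
proof -
  have "h (barycenter V) = (\<Sum>v\<in>V. (1 / real (card V)) *\<^sub>R h v)"
    using affine_on_simplexD[OF assms(1) coords_barycenter[OF assms(3,4)]] by (simp cong: sum.cong)
  also have "\<dots> = barycenter (h ` V)"
    using assms(2) by (simp add: barycenter_def sum.reindex card_image scaleR_sum_right)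
  finally show ?thesis .
qed

context
  fixes A B :: "rinf set set" and h :: "rinf \<Rightarrow> rinf"
  assumes A: "finite_complex A" and B: "finite_complex B" and h: "nondegenerate_map A B h"
begin

lemma nondegenerate_map_barycenter:
  assumes "V \<in> A"
  shows "h (barycenter V) = barycenter (h ` V)"
  by (rule affine_image_barycenter[OF nondegenerate_mapD(2,3)[OF h assms]
        simplex_finite[OF A assms] simplex_nonempty[OF A assms]])

text \<open>Inclusions and barycenters are preserved, so flags go to flags. The new vertices all lie
  in the hull of the top member, where \<open>h\<close> is affine and injective.\<close>

lemma nondegenerate_map_barycentric_subdivision:
  "nondegenerate_map (barycentric_subdivision A) (barycentric_subdivision B) h"
  unfolding nondegenerate_map_def simplicial_map_def
proof (intro conjI ballI)
  fix X assume "X \<in> barycentric_subdivision A"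
  then obtain C where C: "X = barycenter ` C" "C \<subseteq> A" "C \<noteq> {}" "chain_subset C"
    by (auto simp: in_barycentric_subdivision)
  have U: "\<Union>C \<in> A"
    by (rule chain_Union_mem[OF A C(2-4)])
  have X: "X \<subseteq> convex hull (\<Union>C)"
    using barycenters_subset_hull[OF A C(2-4)] C(1) by simp
  show "affine_on_simplex X h"
    by (rule affine_on_simplex_subset_hull[OF nondegenerate_mapD(2)[OF h U] X simplex_finite[OF A U]])
  show "inj_on h X"
    by (rule inj_on_subset[OF nondegenerate_map_inj_on_hull[OF h U A B] X])
  have "h ` X = barycenter ` (\<lambda>V. h ` V) ` C"
    using C(2) nondegenerate_map_barycenter unfolding C(1) image_image by (intro image_cong) auto
  moreover have "(\<lambda>V. h ` V) ` C \<subseteq> B"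
    using C(2) nondegenerate_mapD(1)[OF h] by blast
  moreover have "chain_subset ((\<lambda>V. h ` V) ` C)"
    using C(4) unfolding chain_subset_def by blast
  ultimately show "h ` X \<in> barycentric_subdivision B"
    using C(3) unfolding in_barycentric_subdivision by blast
qed

text \<open>
  On a flag the characteristic map only records dimensions, and these are preserved by \<open>h\<close>.
\<close>

lemma barycentric_char_natural:
  assumes "x \<in> underlying A"
  shows "barycentric_char B (h x) = barycentric_char A x"
proof -
  note sA = finite_complex_barycentric_subdivision[OF A]
  note sB = finite_complex_barycentric_subdivision[OF B]
  have "x \<in> underlying (barycentric_subdivision A)"
    using assms underlying_barycentric_subdivision[OF A] by simp
  then obtain X u where X: "X \<in> barycentric_subdivision A" "coords X u x"
    unfolding underlying_coords[OF sA] by blast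
  have "h ` X \<in> barycentric_subdivision B"
    by (rule nondegenerate_mapD(1)[OF nondegenerate_map_barycentric_subdivision X(1)])
  then have "affine_on_simplex (h ` X) (barycentric_char B)"
    unfolding barycentric_char_def by (rule affine_on_simplex_simplicial_extension[OF sB])
  then have "affine_on_simplex X (\<lambda>x. barycentric_char B (h x))"
    by (rule affine_on_simplex_compose[OF nondegenerate_mapD(2)[OF
            nondegenerate_map_barycentric_subdivision X(1)] _ simplex_finite[OF sA X(1)]])
  from affine_on_simplexD[OF this X(2)]
  have "barycentric_char B (h x) = (\<Sum>b\<in>X. u b *\<^sub>R barycentric_char B (h b))" .
  also have "\<dots> = (\<Sum>b\<in>X. u b *\<^sub>R barycentric_char A b)"
  proof (intro sum.cong refl)
    fix b assume "b \<in> X"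
    then obtain V where V: "V \<in> A" "b = barycenter V"
      using X(1) by (auto simp: in_barycentric_subdivision)
    have "card (h ` V) = card V"
      by (rule card_image[OF nondegenerate_mapD(3)[OF h V(1)]])
    then have "barycentric_char B (h b) = barycentric_char A b"
      using V nondegenerate_map_barycenter[OF V(1)] barycentric_char_barycenter[OF A V(1)]
        barycentric_char_barycenter[OF B nondegenerate_mapD(1)[OF h V(1)]] by simp
    then show "u b *\<^sub>R barycentric_char B (h b) = u b *\<^sub>R barycentric_char A b"
      by simp
  qed
  also have "\<dots> = barycentric_char A x"
    unfolding barycentric_char_def
    by (rule affine_on_simplexD[OF affine_on_simplex_simplicial_extension[OF sA X(1)] X(2), symmetric])
  finally show ?thesis .
qed

end

section \<open>The induced subdivision\<close>

lemma lookup_scaleR: "Poly_Mapping.lookup (r *\<^sub>R x) i = r *\<^sub>R Poly_Mapping.lookup x i"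
proof -
  have "{i. r *\<^sub>R Poly_Mapping.lookup x i \<noteq> 0} \<subseteq> Poly_Mapping.keys x"
    by (auto simp: in_keys_iff)
  then have "finite {i. r *\<^sub>R Poly_Mapping.lookup x i \<noteq> 0}"
    using finite_keys finite_subset by blast
  then show ?thesis
    by (simp add: scaleR_poly_mapping_def)
qed

lemma lookup_convex_sum:
  "Poly_Mapping.lookup (\<Sum>v\<in>V. u v *\<^sub>R v) i = (\<Sum>v\<in>V. u v *\<^sub>R Poly_Mapping.lookup v i)"
  by (simp add: lookup_sum lookup_scaleR)

lemma lookup_unit_vertex: "Poly_Mapping.lookup (unit_vertex i) j = (if i = j then 1 else 0)"
  by (simp add: unit_vertex_def lookup_single when_def)

lemma lookup_sum_unit_vertices:
  assumes "finite I"
  shows "Poly_Mapping.lookup (\<Sum>i\<in>I. a i *\<^sub>R unit_vertex i) j = (if j \<in> I then a j else 0)"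
  using assms by (simp add: lookup_sum lookup_scaleR lookup_unit_vertex sum.delta if_distrib cong: if_cong)

lemma coords_unit_vertices:
  assumes "finite I" "coords (unit_vertex ` I) u x"
  shows "Poly_Mapping.lookup x j = u (unit_vertex j)"
proof -
  have inj: "inj_on unit_vertex I"
    using inj_unit_vertex by (rule inj_on_subset) simp
  have "x = (\<Sum>i\<in>I. u (unit_vertex i) *\<^sub>R unit_vertex i)"
    using assms(2) by (simp add: coords_def sum.reindex[OF inj])
  then have "Poly_Mapping.lookup x j = (if j \<in> I then u (unit_vertex j) else 0)"
    using lookup_sum_unit_vertices[OF assms(1), of "\<lambda>i. u (unit_vertex i)" j] by simp
  moreover have "u (unit_vertex j) = 0" if "j \<notin> I"
    using that coords_outside[OF assms(2)] inj_unit_vertex by (simp add: inj_image_mem_iff)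
  ultimately show ?thesis
    by simp
qed

lemma in_hull_unit_vertices_iff:
  assumes "finite I"
  shows "x \<in> convex hull (unit_vertex ` I) \<longleftrightarrow>
    (\<forall>j. 0 \<le> Poly_Mapping.lookup x j) \<and> (\<forall>j. j \<notin> I \<longrightarrow> Poly_Mapping.lookup x j = 0) \<and>
    (\<Sum>j\<in>I. Poly_Mapping.lookup x j) = 1"
    (is "_ \<longleftrightarrow> ?nonneg \<and> ?out \<and> ?sum")
proof
  have inj: "inj_on unit_vertex I"
    using inj_unit_vertex by (rule inj_on_subset) simp
  assume "x \<in> convex hull (unit_vertex ` I)"
  then obtain u where u: "coords (unit_vertex ` I) u x"
    using assms by (auto simp: in_convex_hull_iff_coords)
  have "u (unit_vertex j) = 0" if "j \<notin> I" for j
    using that coords_outside[OF u] inj_unit_vertex by (simp add: inj_image_mem_iff)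
  moreover have "(\<Sum>j\<in>I. u (unit_vertex j)) = 1"
    using u by (simp add: coords_def sum.reindex[OF inj])
  ultimately show "?nonneg \<and> ?out \<and> ?sum"
    using coords_nonneg[OF u] by (simp add: coords_unit_vertices[OF assms u])
next
  assume x: "?nonneg \<and> ?out \<and> ?sum"
  have "x = (\<Sum>i\<in>I. Poly_Mapping.lookup x i *\<^sub>R unit_vertex i)"
    by (rule poly_mapping_eqI) (simp add: lookup_sum_unit_vertices[OF assms] x)
  moreover have "\<dots> \<in> convex hull (unit_vertex ` I)"
    using x assms by (intro convex_sum) (auto simp: hull_inc)
  ultimately show "x \<in> convex hull (unit_vertex ` I)"
    by simp
qed

lemma std_simplex_iff: "V \<in> std_simplex n \<longleftrightarrow> (\<exists>I\<subseteq>{..n}. I \<noteq> {} \<and> V = unit_vertex ` I)"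
  by (auto simp: std_simplex_def subset_image_iff)

lemma finite_complex_std_simplex: "finite_complex (std_simplex n)"
  unfolding finite_complex_iff_coords_unique
proof (intro conjI)
  have "std_simplex n \<subseteq> Pow (unit_vertex ` {..n})"
    by (auto simp: std_simplex_def)
  then show "finite (std_simplex n)"
    using finite_subset by blast
  show "\<forall>V\<in>std_simplex n. finite V \<and> V \<noteq> {}"
    using finite_subset by (auto simp: std_simplex_def)
  show "\<forall>V\<in>std_simplex n. \<forall>W. W \<subseteq> V \<and> W \<noteq> {} \<longrightarrow> W \<in> std_simplex n"
    by (auto simp: std_simplex_def)
  show "\<forall>V\<in>std_simplex n. \<forall>W\<in>std_simplex n. \<forall>u w x. coords V u x \<longrightarrow> coords W w x \<longrightarrow> u = w"
  proof (intro ballI allI impI)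
    fix V W u w x assume "V \<in> std_simplex n" "W \<in> std_simplex n"
      and u: "coords V u x" and w: "coords W w x"
    then obtain I J where I: "I \<subseteq> {..n}" "V = unit_vertex ` I"
      and J: "J \<subseteq> {..n}" "W = unit_vertex ` J"
      by (auto simp: std_simplex_iff)
    have "finite I" "finite J"
      using I J finite_subset by blast+
    then have eq: "u (unit_vertex j) = w (unit_vertex j)" for j
      using coords_unit_vertices[of I u x j] coords_unit_vertices[of J w x j] u w I J by simp
    show "u = w"
    proof
      fix v
      show "u v = w v"
      proof (cases "v \<in> range unit_vertex")
        case True
        then show ?thesis
          using eq by blast
      next
        case False
        then have "v \<notin> V" "v \<notin> W"
          using I J by blast+
        then show ?thesis
          using coords_outside[OF u] coords_outside[OF w] by simp
      qed
    qed
  qed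
qed

lemma underlying_std_simplex: "underlying (std_simplex n) = convex hull (unit_vertex ` {..n})"
proof -
  have "unit_vertex ` {..n} \<in> std_simplex n"
    by (simp add: std_simplex_def)
  moreover have "convex hull V \<subseteq> convex hull (unit_vertex ` {..n})" if "V \<in> std_simplex n" for V
    using that by (intro hull_mono) (simp add: std_simplex_def)
  ultimately show ?thesis
    unfolding underlying_def by blast
qed

text \<open>Faces are extreme: a coordinate that vanishes at \<open>x\<close> is a positive
  combination of the nonnegative coordinates of the points of \<open>T\<close>, so it vanishes at
  all of them.\<close>

lemma positive_coords_subset_face:
  assumes V: "V \<in> std_simplex n" and x: "x \<in> convex hull V"
    and T: "coords T u x" "finite T" "\<And>t. t \<in> T \<Longrightarrow> 0 < u t" "T \<subseteq> underlying (std_simplex n)"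
  shows "T \<subseteq> convex hull V"
proof
  fix t assume t: "t \<in> T"
  obtain I where I: "I \<subseteq> {..n}" "V = unit_vertex ` I"
    using V by (auto simp: std_simplex_iff)
  have fin: "finite I"
    using I(1) finite_subset by blast
  have T': "(\<forall>j. 0 \<le> Poly_Mapping.lookup s j) \<and> (\<forall>j. j \<notin> {..n} \<longrightarrow> Poly_Mapping.lookup s j = 0) \<and>
    (\<Sum>j\<in>{..n}. Poly_Mapping.lookup s j) = 1" if "s \<in> T" for s
    using that T(4) by (auto simp: underlying_std_simplex in_hull_unit_vertices_iff)
  have out: "Poly_Mapping.lookup t j = 0" if "j \<notin> I" for j
  proof -
    have "Poly_Mapping.lookup x j = 0"
      using x that unfolding I(2) in_hull_unit_vertices_iff[OF fin] by blast
    moreover have "x = (\<Sum>s\<in>T. u s *\<^sub>R s)"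
      using coords_sum[OF T(1)] by simp
    ultimately have "(\<Sum>s\<in>T. u s * Poly_Mapping.lookup s j) = 0"
      using lookup_convex_sum[of u T j] by simp
    moreover have "0 \<le> u s * Poly_Mapping.lookup s j" if "s \<in> T" for s
      using T'[OF that] T(3)[OF that] by simp
    ultimately have "u t * Poly_Mapping.lookup t j = 0"
      using t T(2) by (simp add: sum_nonneg_eq_0_iff)
    then show ?thesis
      using T(3)[OF t] by simp
  qed
  have "(\<Sum>j\<in>I. Poly_Mapping.lookup t j) = (\<Sum>j\<in>{..n}. Poly_Mapping.lookup t j)"
    using I(1) out by (intro sum.mono_neutral_left) auto
  then show "t \<in> convex hull V"
    unfolding I(2) in_hull_unit_vertices_iff[OF fin] using T'[OF t] out by simp
qed

section \<open>The subdivision pulled back along a characteristic map\<close>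

locale triangulated_over =
  fixes n :: nat and \<tau> K :: "rinf set set" and \<kappa> :: "rinf \<Rightarrow> rinf"
  assumes complex_K: "finite_complex K" and complex_\<tau>: "finite_complex \<tau>"
    and underlying_\<tau>: "underlying \<tau> = underlying (std_simplex n)"
    and nondegenerate_\<kappa>: "nondegenerate_map K (std_simplex n) \<kappa>"
begin

lemma \<kappa>_inj: "V \<in> K \<Longrightarrow> inj_on \<kappa> (convex hull V)"
  by (rule nondegenerate_map_inj_on_hull[OF nondegenerate_\<kappa> _ complex_K finite_complex_std_simplex])

lemma \<kappa>_hull: "V \<in> K \<Longrightarrow> \<kappa> ` (convex hull V) = convex hull (\<kappa> ` V)"
  by (rule affine_image_hull[OF nondegenerate_mapD(2)[OF nondegenerate_\<kappa>] simplex_finite[OF complex_K]])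

lemma \<kappa>_affine: "V \<in> K \<Longrightarrow> S \<subseteq> convex hull V \<Longrightarrow> affine_on_simplex S \<kappa>"
  by (rule affine_on_simplex_subset_hull[OF nondegenerate_mapD(2)[OF nondegenerate_\<kappa>] _
        simplex_finite[OF complex_K]])

text \<open>The carrier in \<open>\<tau>\<close> of a point over a face stays in that face, so it
  can be lifted into the simplex \<open>V\<close> itself.\<close>

lemma \<tau>_subset_face:
  assumes "V \<in> K" "x \<in> convex hull (\<kappa> ` V)" "T \<in> \<tau>" "coords T u x" "\<And>t. t \<in> T \<Longrightarrow> 0 < u t"
  shows "T \<subseteq> \<kappa> ` (convex hull V)"
proof -
  have "T \<subseteq> underlying (std_simplex n)"
    using assms(3) underlying_\<tau> hull_subset[of T convex] unfolding underlying_def by blast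
  then show ?thesis
    using positive_coords_subset_face[OF nondegenerate_mapD(1)[OF nondegenerate_\<kappa> assms(1)] assms(2,4)]
      simplex_finite[OF complex_\<tau> assms(3)] assms(5) \<kappa>_hull[OF assms(1)] by simp
qed

lemma in_induced_subdivision:
  "S \<in> induced_subdivision \<tau> K \<kappa> \<longleftrightarrow> (\<exists>V\<in>K. S \<subseteq> convex hull V) \<and> \<kappa> ` S \<in> \<tau>"
proof
  assume "S \<in> induced_subdivision \<tau> K \<kappa>"
  then obtain V T where V: "S = {x \<in> convex hull V. \<kappa> x \<in> T}" "V \<in> K" "T \<in> \<tau>"
      "T \<subseteq> convex hull (\<kappa> ` V)"
    unfolding induced_subdivision_def by blast
  have "T \<subseteq> \<kappa> ` (convex hull V)"
    using V(4) \<kappa>_hull[OF V(2)] by simp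
  then have "\<kappa> ` S = T"
    unfolding V(1) by blast
  then show "(\<exists>V\<in>K. S \<subseteq> convex hull V) \<and> \<kappa> ` S \<in> \<tau>"
    using V by blast
next
  assume "(\<exists>V\<in>K. S \<subseteq> convex hull V) \<and> \<kappa> ` S \<in> \<tau>"
  then obtain V where V: "V \<in> K" "S \<subseteq> convex hull V" "\<kappa> ` S \<in> \<tau>"
    by blast
  have "S = {x \<in> convex hull V. \<kappa> x \<in> \<kappa> ` S}"
    using V(2) inj_onD[OF \<kappa>_inj[OF V(1)]] by blast
  moreover have "\<kappa> ` S \<subseteq> convex hull (\<kappa> ` V)"
    using V(2) \<kappa>_hull[OF V(1)] by blast
  ultimately show "S \<in> induced_subdivision \<tau> K \<kappa>"
    using V(1,3) unfolding induced_subdivision_def by blast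
qed

lemma induced_subdivision_finite:
  assumes "S \<in> induced_subdivision \<tau> K \<kappa>"
  shows "finite S"
proof -
  obtain V where V: "V \<in> K" "S \<subseteq> convex hull V" "\<kappa> ` S \<in> \<tau>"
    using assms by (auto simp: in_induced_subdivision)
  then show ?thesis
    using finite_imageD[OF _ inj_on_subset[OF \<kappa>_inj[OF V(1)] V(2)]] simplex_finite[OF complex_\<tau>] by blast
qed

text \<open>In \<open>\<tau>\<close> both coordinate functions push forward to the same one, so
  \<open>s\<close> has a partner in \<open>S'\<close> with the same image and the same weight; the
  partner must be \<open>s\<close>. This treats the support of \<open>u\<close>, and exchanging the
  two simplices completes uniqueness.\<close>

lemma induced_subdivision_coords_le:
  assumes S: "S \<in> induced_subdivision \<tau> K \<kappa>" "coords S u x"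
    and S': "S' \<in> induced_subdivision \<tau> K \<kappa>" "coords S' u' x"
    and s: "u s \<noteq> 0"
  shows "u' s = u s"
proof -
  obtain V where V: "V \<in> K" "S \<subseteq> convex hull V" "\<kappa> ` S \<in> \<tau>"
    using S(1) by (auto simp: in_induced_subdivision)
  obtain V' where V': "V' \<in> K" "S' \<subseteq> convex hull V'" "\<kappa> ` S' \<in> \<tau>"
    using S'(1) by (auto simp: in_induced_subdivision)
  have inj: "inj_on \<kappa> S" "inj_on \<kappa> S'"
    using inj_on_subset[OF \<kappa>_inj] V V' by blast+
  note fin = induced_subdivision_finite[OF S(1)] induced_subdivision_finite[OF S'(1)]
  define p where "p t = (\<Sum>s | s \<in> S \<and> \<kappa> s = t. u s)" for t
  define p' where "p' t = (\<Sum>s | s \<in> S' \<and> \<kappa> s = t. u' s)" for t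
  have p: "coords (\<kappa> ` S) p (\<kappa> x)" and p': "coords (\<kappa> ` S') p' (\<kappa> x)"
    using coords_image[OF \<kappa>_affine[OF V(1,2)] S(2) fin(1)]
      coords_image[OF \<kappa>_affine[OF V'(1,2)] S'(2) fin(2)] unfolding p_def[abs_def] p'_def[abs_def] by blast+
  have eq: "p = p'"
    by (rule simplex_coords_unique[OF complex_\<tau> V(3) V'(3) p p'])
  have sS: "s \<in> S"
    using s coords_outside[OF S(2)] by blast
  have ps: "p (\<kappa> s) = u s"
    unfolding p_def by (rule coords_image_inj[OF inj(1) sS])
  then have "\<kappa> s \<in> \<kappa> ` S'"
    using s eq coords_outside[OF p'] by metis
  then obtain s' where s': "s' \<in> S'" "\<kappa> s = \<kappa> s'"
    by blast
  have "p' (\<kappa> s') = u' s'"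
    unfolding p'_def by (rule coords_image_inj[OF inj(2) s'(1)])
  then have us: "u' s' = u s"
    using ps eq s'(2) by simp
  \<comment> \<open>Since \<open>S\<close> and \<open>S'\<close> may lie in different simplices of
    \<open>K\<close>, equal images alone do not give \<open>s = s'\<close>. The carrier of
    \<open>\<kappa> x\<close> lies over the common face, so the common image has a preimage there,
    and injectivity on \<open>V\<close> and on \<open>V'\<close> identifies this preimage with
    both.\<close>
  let ?F = "V \<inter> V'"
  let ?T = "{t. p t \<noteq> 0}"
  have "x \<in> convex hull V"
    using coords_in_hull[OF S(2) fin(1)] V(2) by (meson convex_convex_hull hull_minimal subsetD)
  moreover have "x \<in> convex hull V'"
    using coords_in_hull[OF S'(2) fin(2)] V'(2) by (meson convex_convex_hull hull_minimal subsetD)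
  ultimately have x: "x \<in> convex hull ?F"
    using complex_K V(1) V'(1) unfolding finite_complex_def by blast
  then have "?F \<noteq> {}"
    by force
  then have F: "?F \<in> K"
    using simplex_face[OF complex_K V(1)] by blast
  have "\<kappa> x \<in> convex hull (\<kappa> ` ?F)"
    using x \<kappa>_hull[OF F] by blast
  then have "?T \<subseteq> \<kappa> ` (convex hull ?F)"
    using simplex_support[OF complex_\<tau> V(3) p] coords_support(1)[OF p] fin(1) coords_nonneg[OF p]
    by (intro \<tau>_subset_face[OF F, of _ _ p]) (auto simp: order_less_le)
  then have "\<kappa> s \<in> \<kappa> ` (convex hull ?F)"
    using ps s by auto
  then obtain y where y: "y \<in> convex hull ?F" "\<kappa> s = \<kappa> y"
    by blast
  have "y \<in> convex hull V" "y \<in> convex hull V'"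
    using y(1) hull_mono[of ?F V] hull_mono[of ?F V'] by blast+
  then have "s = y" "s' = y"
    using inj_onD[OF \<kappa>_inj[OF V(1)], of s y] inj_onD[OF \<kappa>_inj[OF V'(1)], of s' y] y(2) s' sS V(2) V'(2)
    by auto
  then show ?thesis
    using us by simp
qed

lemma finite_complex_induced_subdivision: "finite_complex (induced_subdivision \<tau> K \<kappa>)"
  unfolding finite_complex_iff_coords_unique
proof (intro conjI)
  have "induced_subdivision \<tau> K \<kappa> \<subseteq> (\<lambda>(V, T). {x \<in> convex hull V. \<kappa> x \<in> T}) ` (K \<times> \<tau>)"
    unfolding induced_subdivision_def by auto
  then show "finite (induced_subdivision \<tau> K \<kappa>)"
    using finite_complex_finite[OF complex_K] finite_complex_finite[OF complex_\<tau>]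
    by (meson finite_SigmaI finite_imageI finite_subset)
  show "\<forall>S\<in>induced_subdivision \<tau> K \<kappa>. finite S \<and> S \<noteq> {}"
    using induced_subdivision_finite simplex_nonempty[OF complex_\<tau>]
    by (metis image_is_empty in_induced_subdivision)
  show "\<forall>S\<in>induced_subdivision \<tau> K \<kappa>. \<forall>W. W \<subseteq> S \<and> W \<noteq> {} \<longrightarrow> W \<in> induced_subdivision \<tau> K \<kappa>"
  proof (intro ballI allI impI)
    fix S W assume "S \<in> induced_subdivision \<tau> K \<kappa>" and W: "W \<subseteq> S \<and> W \<noteq> {}"
    then obtain V where V: "V \<in> K" "S \<subseteq> convex hull V" "\<kappa> ` S \<in> \<tau>"
      by (auto simp: in_induced_subdivision)
    have "\<kappa> ` W \<in> \<tau>"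
      using W by (intro simplex_face[OF complex_\<tau> V(3)]) auto
    then show "W \<in> induced_subdivision \<tau> K \<kappa>"
      unfolding in_induced_subdivision using V W by blast
  qed
  show "\<forall>S\<in>induced_subdivision \<tau> K \<kappa>. \<forall>S'\<in>induced_subdivision \<tau> K \<kappa>.
      \<forall>u w x. coords S u x \<longrightarrow> coords S' w x \<longrightarrow> u = w"
  proof (intro ballI allI impI ext)
    fix S S' u w x s
    assume "S \<in> induced_subdivision \<tau> K \<kappa>" "S' \<in> induced_subdivision \<tau> K \<kappa>"
      "coords S u x" "coords S' w x"
    then show "u s = w s"
      using induced_subdivision_coords_le[of S u x S' w s] induced_subdivision_coords_le[of S' w x S u s]
      by fastforce
  qed
qed

text \<open>For the harder inclusion, the carrier of \<open>\<kappa> x\<close> in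
  \<open>\<tau>\<close> is lifted into a simplex \<open>V\<close> containing \<open>x\<close>; by
  injectivity the lifted simplex contains \<open>x\<close> itself.\<close>

lemma underlying_induced_subdivision: "underlying (induced_subdivision \<tau> K \<kappa>) = underlying K"
proof
  show "underlying (induced_subdivision \<tau> K \<kappa>) \<subseteq> underlying K"
  proof
    fix x assume "x \<in> underlying (induced_subdivision \<tau> K \<kappa>)"
    then obtain S V where "x \<in> convex hull S" "V \<in> K" "S \<subseteq> convex hull V"
      by (auto simp: underlying_def in_induced_subdivision)
    then show "x \<in> underlying K"
      unfolding underlying_def by (meson UN_I convex_convex_hull hull_minimal subsetD)
  qed
  show "underlying K \<subseteq> underlying (induced_subdivision \<tau> K \<kappa>)"
  proof
    fix x assume "x \<in> underlying K"
    then obtain V where V: "V \<in> K" "x \<in> convex hull V"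
      by (auto simp: underlying_def)
    then have \<kappa>x: "\<kappa> x \<in> convex hull (\<kappa> ` V)"
      using \<kappa>_hull by blast
    then have "\<kappa> x \<in> underlying \<tau>"
      using nondegenerate_mapD(1)[OF nondegenerate_\<kappa> V(1)] underlying_\<tau> unfolding underlying_def by blast
    then obtain T u where T: "T \<in> \<tau>" "coords T u (\<kappa> x)" "\<And>t. t \<in> T \<Longrightarrow> 0 < u t"
      using underlying_positive_coords[OF complex_\<tau>] by blast
    have sub: "T \<subseteq> \<kappa> ` (convex hull V)"
      by (rule \<tau>_subset_face[OF V(1) \<kappa>x T])
    define S where "S = {y \<in> convex hull V. \<kappa> y \<in> T}"
    have S: "S \<subseteq> convex hull V" "\<kappa> ` S = T"
      using sub by (auto simp: S_def)
    then have "S \<in> induced_subdivision \<tau> K \<kappa>"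
      using V(1) T(1) in_induced_subdivision by blast
    moreover from this have "\<kappa> x \<in> \<kappa> ` (convex hull S)"
      using affine_image_hull[OF \<kappa>_affine[OF V(1) S(1)]] S(2) induced_subdivision_finite
        coords_in_hull[OF T(2) simplex_finite[OF complex_\<tau> T(1)]] by simp
    then obtain x' where x': "x' \<in> convex hull S" "\<kappa> x = \<kappa> x'"
      by blast
    moreover have "x' \<in> convex hull V"
      using x'(1) S(1) by (meson convex_convex_hull hull_minimal subsetD)
    then have "x = x'"
      using inj_onD[OF \<kappa>_inj[OF V(1)]] V(2) x'(2) by blast
    ultimately show "x \<in> underlying (induced_subdivision \<tau> K \<kappa>)"
      unfolding underlying_def by blast
  qed
qed

lemma subdivides_induced_subdivision: "subdivides (induced_subdivision \<tau> K \<kappa>) K"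
  unfolding subdivides_def
proof (intro conjI ballI)
  fix S assume "S \<in> induced_subdivision \<tau> K \<kappa>"
  then obtain V where V: "V \<in> K" "S \<subseteq> convex hull V"
    by (auto simp: in_induced_subdivision)
  then have "convex hull S \<subseteq> convex hull V"
    by (simp add: subset_hull)
  then show "\<exists>W\<in>K. convex hull S \<subseteq> convex hull W"
    using V(1) by blast
qed (rule finite_complex_induced_subdivision complex_K underlying_induced_subdivision)+

end

section \<open>Pull-backs\<close>

lemma norm_rinf: "norm (x :: rinf) = (\<Sum>i\<in>Poly_Mapping.keys x. \<bar>Poly_Mapping.lookup x i\<bar>)"
  by (simp add: norm_poly_mapping_def dist_poly_mapping_def)

lemma norm_rinf_superset:
  assumes "finite A" "Poly_Mapping.keys x \<subseteq> A"
  shows "norm (x :: rinf) = (\<Sum>i\<in>A. \<bar>Poly_Mapping.lookup x i\<bar>)"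
  unfolding norm_rinf using assms by (intro sum.mono_neutral_left) (auto simp: in_keys_iff)

text \<open>The norm is the sum of the absolute values of the coordinates, so each coordinate is
  bounded with constant 1.\<close>

lemma bounded_linear_lookup: "bounded_linear (\<lambda>x :: rinf. Poly_Mapping.lookup x i)"
proof (rule bounded_linear_intro[where K = 1])
  fix x :: rinf
  show "norm (Poly_Mapping.lookup x i) \<le> norm x * 1"
  proof (cases "i \<in> Poly_Mapping.keys x")
    case True
    then show ?thesis
      unfolding norm_rinf mult_1_right real_norm_def by (intro member_le_sum) auto
  qed (simp add: in_keys_iff)
qed (simp_all add: lookup_add lookup_scaleR)

lemma lookup_map_key: "inj p \<Longrightarrow> Poly_Mapping.lookup (Poly_Mapping.map_key p x) k = Poly_Mapping.lookup x (p k)"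
  by (simp add: map_key.rep_eq)

text \<open>Pulling back along an injection re-indexes some terms of the norm and drops the others;
  hence the constant 1.\<close>

lemma bounded_linear_map_key:
  assumes "inj p"
  shows "bounded_linear (Poly_Mapping.map_key p :: rinf \<Rightarrow> rinf)"
proof (rule bounded_linear_intro[where K = 1])
  fix x y :: rinf and r :: real
  show "Poly_Mapping.map_key p (x + y) = Poly_Mapping.map_key p x + Poly_Mapping.map_key p y"
    by (rule map_key_plus[OF assms])
  show "Poly_Mapping.map_key p (r *\<^sub>R x) = r *\<^sub>R Poly_Mapping.map_key p x"
    by (rule poly_mapping_eqI) (simp add: lookup_map_key[OF assms] lookup_scaleR)
  have inj: "inj_on p (Poly_Mapping.keys (Poly_Mapping.map_key p x))"
    using assms by (rule inj_on_subset) simp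
  have "norm (Poly_Mapping.map_key p x) =
      (\<Sum>k\<in>p ` Poly_Mapping.keys (Poly_Mapping.map_key p x). \<bar>Poly_Mapping.lookup x k\<bar>)"
    by (simp add: norm_rinf lookup_map_key[OF assms] sum.reindex[OF inj])
  also have "\<dots> \<le> norm x"
    unfolding norm_rinf by (intro sum_mono2) (auto simp: keys_map_key[OF assms])
  finally show "norm (Poly_Mapping.map_key p x) \<le> norm x * 1"
    by simp
qed

text \<open>For injective \<open>p\<close> a section of \<open>Poly_Mapping.map_key p\<close>: keys
  are pushed forward, and the new coordinates off the range of \<open>p\<close> are zero.\<close>

definition extend_key :: "(nat \<Rightarrow> nat) \<Rightarrow> rinf \<Rightarrow> rinf" where
  "extend_key p x = (\<Sum>k\<in>Poly_Mapping.keys x. Poly_Mapping.single (p k) (Poly_Mapping.lookup x k))"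

lemma lookup_extend_key:
  assumes "inj p"
  shows "Poly_Mapping.lookup (extend_key p x) (p k) = Poly_Mapping.lookup x k"
    and "j \<notin> range p \<Longrightarrow> Poly_Mapping.lookup (extend_key p x) j = 0"
proof -
  have "(\<Sum>l\<in>Poly_Mapping.keys x. if p l = p k then Poly_Mapping.lookup x l else 0) =
      (\<Sum>l\<in>Poly_Mapping.keys x. if l = k then Poly_Mapping.lookup x k else 0)"
    using assms by (intro sum.cong) (auto simp: inj_eq)
  then show "Poly_Mapping.lookup (extend_key p x) (p k) = Poly_Mapping.lookup x k"
    by (simp add: extend_key_def lookup_sum lookup_single when_def in_keys_iff)
  assume "j \<notin> range p"
  then show "Poly_Mapping.lookup (extend_key p x) j = 0"
    unfolding extend_key_def lookup_sum lookup_single when_def by (intro sum.neutral) auto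
qed

lemma bounded_linear_extend_key:
  assumes "inj p"
  shows "bounded_linear (extend_key p)"
proof (rule bounded_linear_intro[where K = 1])
  note le = lookup_extend_key[OF assms]
  fix x y :: rinf and r :: real
  show "extend_key p (x + y) = extend_key p x + extend_key p y"
  proof (rule poly_mapping_eqI)
    fix j show "Poly_Mapping.lookup (extend_key p (x + y)) j =
        Poly_Mapping.lookup (extend_key p x + extend_key p y) j"
      by (cases "j \<in> range p") (auto simp: le lookup_add)
  qed
  show "extend_key p (r *\<^sub>R x) = r *\<^sub>R extend_key p x"
  proof (rule poly_mapping_eqI)
    fix j show "Poly_Mapping.lookup (extend_key p (r *\<^sub>R x)) j =
        Poly_Mapping.lookup (r *\<^sub>R extend_key p x) j"
      by (cases "j \<in> range p") (auto simp: le lookup_scaleR)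
  qed
  have "j \<in> p ` Poly_Mapping.keys x" if "j \<in> Poly_Mapping.keys (extend_key p x)" for j
    using that le by (cases "j \<in> range p") (auto simp: in_keys_iff)
  then have "norm (extend_key p x) = (\<Sum>j\<in>p ` Poly_Mapping.keys x. \<bar>Poly_Mapping.lookup (extend_key p x) j\<bar>)"
    by (intro norm_rinf_superset) auto
  also have "\<dots> = norm x"
    using inj_on_subset[OF assms, of "Poly_Mapping.keys x"]
    by (subst sum.reindex) (auto simp: le norm_rinf)
  finally show "norm (extend_key p x) \<le> norm x * 1"
    by simp
qed

lemma inj_double: "inj (\<lambda>k::nat. 2 * k)" "inj (\<lambda>k::nat. 2 * k + 1)"
  by (auto intro: injI)

lemma lookup_pr1: "Poly_Mapping.lookup (pr1 z) k = Poly_Mapping.lookup z (2 * k)"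
  unfolding pr1_def by (rule lookup_map_key[OF inj_double(1)])

lemma lookup_pr2: "Poly_Mapping.lookup (pr2 z) k = Poly_Mapping.lookup z (2 * k + 1)"
  unfolding pr2_def by (rule lookup_map_key[OF inj_double(2)])

definition pair_rinf :: "rinf \<Rightarrow> rinf \<Rightarrow> rinf" where
  "pair_rinf x y = extend_key (\<lambda>k. 2 * k) x + extend_key (\<lambda>k. 2 * k + 1) y"

lemma pr1_pair_rinf [simp]: "pr1 (pair_rinf x y) = x"
proof (rule poly_mapping_eqI)
  fix k
  have "2 * k \<notin> range (\<lambda>k::nat. 2 * k + 1)"
    by (auto simp: image_iff) presburger
  then show "Poly_Mapping.lookup (pr1 (pair_rinf x y)) k = Poly_Mapping.lookup x k"
    using lookup_extend_key(1)[OF inj_double(1), of x k] lookup_extend_key(2)[OF inj_double(2), of "2 * k" y]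
    by (simp add: lookup_pr1 pair_rinf_def lookup_add)
qed

lemma pr2_pair_rinf [simp]: "pr2 (pair_rinf x y) = y"
proof (rule poly_mapping_eqI)
  fix k
  have "2 * k + 1 \<notin> range (\<lambda>k::nat. 2 * k)"
    by (auto simp: image_iff) presburger
  then show "Poly_Mapping.lookup (pr2 (pair_rinf x y)) k = Poly_Mapping.lookup y k"
    using lookup_extend_key(1)[OF inj_double(2), of y k] lookup_extend_key(2)[OF inj_double(1), of "2 * k + 1" x]
    by (simp add: lookup_pr2 pair_rinf_def lookup_add)
qed

lemma pr_eqI:
  assumes "pr1 z = pr1 w" "pr2 z = pr2 w"
  shows "z = w"
proof (rule poly_mapping_eqI)
  fix k
  show "Poly_Mapping.lookup z k = Poly_Mapping.lookup w k"
  proof (cases "even k")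
    case True
    then obtain j where "k = 2 * j"
      by blast
    then show ?thesis
      using arg_cong[OF assms(1), of "\<lambda>x. Poly_Mapping.lookup x j"]
      by (simp add: lookup_pr1)
  next
    case False
    then obtain j where "k = 2 * j + 1"
      using oddE by blast
    then show ?thesis
      using arg_cong[OF assms(2), of "\<lambda>x. Poly_Mapping.lookup x j"]
      by (simp add: lookup_pr2)
  qed
qed

lemma pair_rinf_pr [simp]: "pair_rinf (pr1 z) (pr2 z) = z"
  by (rule pr_eqI) simp_all

lemma bounded_linear_pr1: "bounded_linear pr1"
  unfolding pr1_def[abs_def] by (rule bounded_linear_map_key[OF inj_double(1)])

lemma bounded_linear_pr2: "bounded_linear pr2"
  unfolding pr2_def[abs_def] by (rule bounded_linear_map_key[OF inj_double(2)])

lemma linear_pr1: "linear pr1"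
  by (rule bounded_linear.linear[OF bounded_linear_pr1])

lemma linear_pr2: "linear pr2"
  by (rule bounded_linear.linear[OF bounded_linear_pr2])

lemma continuous_on_pair_rinf:
  assumes "continuous_on S g" "continuous_on S h"
  shows "continuous_on S (\<lambda>z. pair_rinf (g z) (h z))"
  unfolding pair_rinf_def
  by (intro continuous_on_add bounded_linear.continuous_on[OF bounded_linear_extend_key] inj_double assms)

lemma affine_on_simplex_pair_rinf:
  assumes "affine_on_simplex V g" "affine_on_simplex V h"
  shows "affine_on_simplex V (\<lambda>z. pair_rinf (g z) (h z))"
proof (rule affine_on_simplexI)
  note lin = bounded_linear.linear[OF bounded_linear_extend_key[OF inj_double(1)]]
    bounded_linear.linear[OF bounded_linear_extend_key[OF inj_double(2)]]
  fix u x assume u: "coords V u x"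
  show "pair_rinf (g x) (h x) = (\<Sum>v\<in>V. u v *\<^sub>R pair_rinf (g v) (h v))"
    unfolding affine_on_simplexD[OF assms(1) u] affine_on_simplexD[OF assms(2) u] pair_rinf_def
    by (simp only: linear_sum[OF lin(1)] linear_sum[OF lin(2)] linear_scale[OF lin(1)]
        linear_scale[OF lin(2)] sum.distrib scaleR_right_distrib)
qed

section \<open>The pull-back complex\<close>

locale pullback_over = triangulated_over +
  fixes L :: "rinf set set" and f :: "rinf \<Rightarrow> rinf"
  assumes complex_L: "finite_complex L" and simplicial_f: "simplicial_map L \<tau> f"
begin

abbreviation "P \<equiv> pullback_complex L \<tau> f K \<kappa>"

text \<open>The two simplices in the definition are recovered as the projections of
  \<open>Z\<close>: every vertex of \<open>W\<close> has a partner because the images in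
  \<open>\<tau>\<close> coincide, and only one because \<open>\<kappa>\<close> is injective on a
  simplex of \<open>K\<close>.\<close>

lemma in_pullback_complex:
  "Z \<in> P \<longleftrightarrow> pr2 ` Z \<in> L \<and> (\<exists>V\<in>K. pr1 ` Z \<subseteq> convex hull V) \<and> (\<forall>z\<in>Z. \<kappa> (pr1 z) = f (pr2 z))"
proof
  assume "Z \<in> P"
  then obtain S W where Z: "Z = {z. pr1 z \<in> S \<and> pr2 z \<in> W \<and> \<kappa> (pr1 z) = f (pr2 z)}"
      and S: "S \<in> induced_subdivision \<tau> K \<kappa>" and W: "W \<in> L" and eq: "\<kappa> ` S = f ` W"
    unfolding pullback_complex_def by blast
  have "W \<subseteq> pr2 ` Z"
  proof
    fix w assume w: "w \<in> W"
    then obtain s where "s \<in> S" "\<kappa> s = f w"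
      using eq by (metis imageE imageI)
    then have "pair_rinf s w \<in> Z"
      using w by (simp add: Z)
    then show "w \<in> pr2 ` Z"
      by (metis image_eqI pr2_pair_rinf)
  qed
  then have "pr2 ` Z = W"
    unfolding Z by blast
  moreover have "pr1 ` Z \<subseteq> S"
    unfolding Z by blast
  ultimately show "pr2 ` Z \<in> L \<and> (\<exists>V\<in>K. pr1 ` Z \<subseteq> convex hull V) \<and> (\<forall>z\<in>Z. \<kappa> (pr1 z) = f (pr2 z))"
    using S W unfolding in_induced_subdivision by (auto simp: Z)
next
  assume Z: "pr2 ` Z \<in> L \<and> (\<exists>V\<in>K. pr1 ` Z \<subseteq> convex hull V) \<and> (\<forall>z\<in>Z. \<kappa> (pr1 z) = f (pr2 z))"
  then obtain V where V: "V \<in> K" "pr1 ` Z \<subseteq> convex hull V"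
    by blast
  have eq: "\<kappa> ` pr1 ` Z = f ` pr2 ` Z"
    unfolding image_image using Z by (intro image_cong) auto
  have "f ` pr2 ` Z \<in> \<tau>"
    using Z simplicial_f unfolding simplicial_map_def by blast
  then have S: "pr1 ` Z \<in> induced_subdivision \<tau> K \<kappa>"
    using V eq by (auto simp: in_induced_subdivision)
  \<comment> \<open>No new pairs arise from recombining components: the second component determines
    \<open>\<kappa>\<close> of the first, hence the first.\<close>
  have "z \<in> Z" if z: "pr1 z \<in> pr1 ` Z" "pr2 z \<in> pr2 ` Z" "\<kappa> (pr1 z) = f (pr2 z)" for z
  proof -
    obtain z' where z': "z' \<in> Z" "pr2 z = pr2 z'"
      using z(2) by blast
    then have "\<kappa> (pr1 z) = \<kappa> (pr1 z')"
      using z(3) Z by simp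
    then have "pr1 z = pr1 z'"
      using inj_onD[OF \<kappa>_inj[OF V(1)]] V(2) z(1) z'(1) by blast
    then show ?thesis
      using z' pr_eqI by blast
  qed
  then have "Z = {z. pr1 z \<in> pr1 ` Z \<and> pr2 z \<in> pr2 ` Z \<and> \<kappa> (pr1 z) = f (pr2 z)}"
    using Z by blast
  then show "Z \<in> P"
    unfolding pullback_complex_def using S Z eq by blast
qed

lemma pullback_pr1:
  assumes "Z \<in> P"
  shows "pr1 ` Z \<in> induced_subdivision \<tau> K \<kappa>"
proof -
  have "\<kappa> ` pr1 ` Z = f ` pr2 ` Z"
    unfolding image_image using assms in_pullback_complex by (intro image_cong) auto
  moreover have "f ` pr2 ` Z \<in> \<tau>"
    using assms simplicial_f unfolding simplicial_map_def in_pullback_complex by blast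
  ultimately show ?thesis
    using assms by (auto simp: in_pullback_complex in_induced_subdivision)
qed

lemma pullback_pr2_inj:
  assumes "Z \<in> P"
  shows "inj_on pr2 Z"
proof (rule inj_onI)
  fix z w assume zw: "z \<in> Z" "w \<in> Z" and eq: "pr2 z = pr2 w"
  obtain V where V: "V \<in> K" "pr1 ` Z \<subseteq> convex hull V"
    using assms in_pullback_complex by blast
  have "\<kappa> (pr1 z) = \<kappa> (pr1 w)"
    using assms zw eq by (simp add: in_pullback_complex)
  then have "pr1 z = pr1 w"
    using inj_onD[OF \<kappa>_inj[OF V(1)]] V(2) zw by blast
  then show "z = w"
    using eq by (rule pr_eqI)
qed

lemma pullback_finite:
  assumes "Z \<in> P"
  shows "finite Z"
proof (rule finite_imageD[OF _ pullback_pr2_inj[OF assms]])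
  show "finite (pr2 ` Z)"
    using assms by (simp add: in_pullback_complex simplex_finite[OF complex_L])
qed

text \<open>Dimensions come from \<open>L\<close> alone, so the bound on cardinalities survives
  every further pull-back.\<close>

lemma pullback_card:
  assumes "Z \<in> P"
  shows "\<exists>W\<in>L. card Z = card W"
proof
  show "pr2 ` Z \<in> L"
    using assms by (simp add: in_pullback_complex)
  show "card Z = card (pr2 ` Z)"
    by (rule card_image[OF pullback_pr2_inj[OF assms], symmetric])
qed

text \<open>Projecting to \<open>L\<close> gives a partner \<open>z'\<close> of \<open>z\<close>
  with the same weight and second component; projecting to the induced subdivision gives some
  \<open>z1\<close> with the right first component. The pull-back equation puts both first
  components over one point, so \<open>\<kappa>\<close> identifies them and
  \<open>z' = z\<close>.\<close>

lemma pullback_coords_le: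
  assumes Z: "Z \<in> P" "coords Z u x" and Z': "Z' \<in> P" "coords Z' u' x" and z: "u z \<noteq> 0"
  shows "u' z = u z"
proof -
  note fin = pullback_finite[OF Z(1)] pullback_finite[OF Z'(1)]
  have zZ: "z \<in> Z"
    using z coords_outside[OF Z(2)] by blast
  have eq2: "(\<lambda>w. \<Sum>v | v \<in> Z \<and> pr2 v = w. u v) = (\<lambda>w. \<Sum>v | v \<in> Z' \<and> pr2 v = w. u' v)"
    using Z(1) Z'(1) unfolding in_pullback_complex
    by (intro simplex_coords_unique[OF complex_L _ _ coords_image[OF _ Z(2) fin(1)]
          coords_image[OF _ Z'(2) fin(2)]] affine_on_simplex_linear linear_pr2) blast+
  have eq1: "(\<lambda>w. \<Sum>v | v \<in> Z \<and> pr1 v = w. u v) = (\<lambda>w. \<Sum>v | v \<in> Z' \<and> pr1 v = w. u' v)"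
    by (intro simplex_coords_unique[OF finite_complex_induced_subdivision
          pullback_pr1[OF Z(1)] pullback_pr1[OF Z'(1)] coords_image[OF _ Z(2) fin(1)]
          coords_image[OF _ Z'(2) fin(2)]] affine_on_simplex_linear linear_pr1)
  have u2: "(\<Sum>v | v \<in> Z' \<and> pr2 v = pr2 z. u' v) = u z"
    using coords_image_inj[OF pullback_pr2_inj[OF Z(1)] zZ, of u] fun_cong[OF eq2, of "pr2 z"] by simp
  then have "{v. v \<in> Z' \<and> pr2 v = pr2 z} \<noteq> {}"
    using z by force
  then obtain z' where z': "z' \<in> Z'" "pr2 z' = pr2 z"
    by blast
  have u': "u' z' = u z"
    using coords_image_inj[OF pullback_pr2_inj[OF Z'(1)] z'(1), of u'] u2 z'(2) by simp
  \<comment> \<open>Since \<open>pr1\<close> may collapse vertices of \<open>Z\<close>, the fibre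
    sum need not equal \<open>u z\<close>; that it is positive suffices to find
    \<open>z1\<close>.\<close>
  have "u z \<le> (\<Sum>v | v \<in> Z \<and> pr1 v = pr1 z. u v)"
    using zZ fin coords_nonneg[OF Z(2)] by (intro member_le_sum) auto
  then have "(\<Sum>v | v \<in> Z' \<and> pr1 v = pr1 z. u' v) \<noteq> 0"
    using fun_cong[OF eq1, of "pr1 z"] z coords_nonneg[OF Z(2), of z] by simp
  then have "{v. v \<in> Z' \<and> pr1 v = pr1 z} \<noteq> {}"
    by force
  then obtain z1 where z1: "z1 \<in> Z'" "pr1 z1 = pr1 z"
    by blast
  obtain V where V: "V \<in> K" "pr1 ` Z' \<subseteq> convex hull V"
    using Z'(1) in_pullback_complex by blast
  have "\<kappa> (pr1 z') = \<kappa> (pr1 z1)"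
    using Z(1) Z'(1) zZ z' z1 unfolding in_pullback_complex by metis
  then have "pr1 z' = pr1 z1"
    using inj_onD[OF \<kappa>_inj[OF V(1)]] V(2) z' z1 by blast
  then have "z' = z"
    using pr_eqI[OF _ z'(2)] z1(2) by simp
  then show ?thesis
    using u' by simp
qed

lemma finite_complex_pullback: "finite_complex P"
  unfolding finite_complex_iff_coords_unique
proof (intro conjI)
  have "P \<subseteq> (\<lambda>(S, W). {z. pr1 z \<in> S \<and> pr2 z \<in> W \<and> \<kappa> (pr1 z) = f (pr2 z)}) `
      (induced_subdivision \<tau> K \<kappa> \<times> L)"
    unfolding pullback_complex_def by auto
  then show "finite P"
    using finite_complex_finite[OF finite_complex_induced_subdivision] finite_complex_finite[OF complex_L]
    by (meson finite_SigmaI finite_imageI finite_subset)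
  show "\<forall>Z\<in>P. finite Z \<and> Z \<noteq> {}"
    using pullback_finite simplex_nonempty[OF complex_L] in_pullback_complex
    by (metis image_is_empty)
  show "\<forall>Z\<in>P. \<forall>W. W \<subseteq> Z \<and> W \<noteq> {} \<longrightarrow> W \<in> P"
  proof (intro ballI allI impI)
    fix Z W assume "Z \<in> P" and W: "W \<subseteq> Z \<and> W \<noteq> {}"
    then have Z: "pr2 ` Z \<in> L" "\<exists>V\<in>K. pr1 ` Z \<subseteq> convex hull V" "\<forall>z\<in>Z. \<kappa> (pr1 z) = f (pr2 z)"
      by (simp_all add: in_pullback_complex)
    have "pr2 ` W \<in> L"
      using W by (intro simplex_face[OF complex_L Z(1)]) auto
    then show "W \<in> P"
      unfolding in_pullback_complex using Z W by blast
  qed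
  show "\<forall>Z\<in>P. \<forall>Z'\<in>P. \<forall>u w x. coords Z u x \<longrightarrow> coords Z' w x \<longrightarrow> u = w"
  proof (intro ballI allI impI ext)
    fix Z Z' u w x z
    assume "Z \<in> P" "Z' \<in> P" "coords Z u x" "coords Z' w x"
    then show "u z = w z"
      using pullback_coords_le[of Z u x Z' w z] pullback_coords_le[of Z' w x Z u z]
      by fastforce
  qed
qed

lemma simplicial_map_pr1: "simplicial_map P (induced_subdivision \<tau> K \<kappa>) pr1"
  unfolding simplicial_map_def by (intro ballI conjI pullback_pr1 affine_on_simplex_linear linear_pr1)

text \<open>On a simplex both sides of the pull-back equation are affine and agree at the vertices.
  Conversely, the carriers of the two components of a point of the fibre product lie over the same
  simplex of \<open>\<tau>\<close>, so they form a simplex of the pull-back.\<close>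

lemma underlying_pullback:
  "underlying P = {z. pr1 z \<in> underlying K \<and> pr2 z \<in> underlying L \<and> \<kappa> (pr1 z) = f (pr2 z)}"
proof (intro set_eqI iffI CollectI)
  fix z assume "z \<in> underlying P"
  then obtain Z u where Z: "Z \<in> P" "coords Z u z"
    using underlying_coords[OF finite_complex_pullback] by blast
  note fin = pullback_finite[OF Z(1)]
  obtain V where V: "V \<in> K" "pr1 ` Z \<subseteq> convex hull V"
    using Z(1) in_pullback_complex by blast
  have W: "pr2 ` Z \<in> L"
    using Z(1) in_pullback_complex by blast
  have hull: "pr1 z \<in> convex hull (pr1 ` Z)" "pr2 z \<in> convex hull (pr2 ` Z)"
    using coords_in_hull[OF coords_image[OF affine_on_simplex_linear[OF linear_pr1] Z(2) fin]]
      coords_in_hull[OF coords_image[OF affine_on_simplex_linear[OF linear_pr2] Z(2) fin]] fin by auto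
  have "pr1 z \<in> convex hull V"
    using hull(1) V(2) by (meson convex_convex_hull hull_minimal subsetD)
  moreover have "\<kappa> (pr1 z) = (\<Sum>v\<in>Z. u v *\<^sub>R \<kappa> (pr1 v))"
    by (rule affine_on_simplexD[OF affine_on_simplex_compose[OF
            affine_on_simplex_linear[OF linear_pr1] \<kappa>_affine[OF V] fin] Z(2)])
  moreover have "f (pr2 z) = (\<Sum>v\<in>Z. u v *\<^sub>R f (pr2 v))"
    using simplicial_f W unfolding simplicial_map_def
    by (intro affine_on_simplexD[OF affine_on_simplex_compose[OF
            affine_on_simplex_linear[OF linear_pr2] _ fin] Z(2)]) blast
  moreover have "(\<Sum>v\<in>Z. u v *\<^sub>R \<kappa> (pr1 v)) = (\<Sum>v\<in>Z. u v *\<^sub>R f (pr2 v))"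
    using Z(1) in_pullback_complex by (intro sum.cong) auto
  ultimately show "pr1 z \<in> underlying K \<and> pr2 z \<in> underlying L \<and> \<kappa> (pr1 z) = f (pr2 z)"
    using V(1) W hull(2) unfolding underlying_def by auto
next
  fix z assume "z \<in> {z. pr1 z \<in> underlying K \<and> pr2 z \<in> underlying L \<and> \<kappa> (pr1 z) = f (pr2 z)}"
  then have z: "pr1 z \<in> underlying (induced_subdivision \<tau> K \<kappa>)" "pr2 z \<in> underlying L"
      "\<kappa> (pr1 z) = f (pr2 z)"
    by (simp_all add: underlying_induced_subdivision)
  obtain S u where S: "S \<in> induced_subdivision \<tau> K \<kappa>" "coords S u (pr1 z)" "\<And>s. s \<in> S \<Longrightarrow> 0 < u s"
    using underlying_positive_coords[OF finite_complex_induced_subdivision z(1)] by blast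
  obtain W w where W: "W \<in> L" "coords W w (pr2 z)" "\<And>v. v \<in> W \<Longrightarrow> 0 < w v"
    using underlying_positive_coords[OF complex_L z(2)] by blast
  obtain V where V: "V \<in> K" "S \<subseteq> convex hull V" "\<kappa> ` S \<in> \<tau>"
    using S(1) by (auto simp: in_induced_subdivision)
  have f: "f ` W \<in> \<tau>" "affine_on_simplex W f"
    using simplicial_f W(1) by (auto simp: simplicial_map_def)
  note fin = induced_subdivision_finite[OF S(1)] simplex_finite[OF complex_L W(1)]
  \<comment> \<open>The weights of both carriers pushed to \<open>\<tau>\<close> are coordinates of
    one point and positive exactly on the two images, so the images coincide.\<close>
  define p where "p = (\<lambda>t. \<Sum>s | s \<in> S \<and> \<kappa> s = t. u s)"
  define q where "q = (\<lambda>t. \<Sum>v | v \<in> W \<and> f v = t. w v)"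
  have p: "coords (\<kappa> ` S) p (f (pr2 z))"
    using coords_image[OF \<kappa>_affine[OF V(1,2)] S(2) fin(1)] z(3) by (simp add: p_def)
  have q: "coords (f ` W) q (f (pr2 z))"
    using coords_image[OF f(2) W(2) fin(2)] by (simp add: q_def)
  have pq: "p = q"
    by (rule simplex_coords_unique[OF complex_\<tau> V(3) f(1) p q])
  have "p t > 0" if t: "t \<in> \<kappa> ` S" for t
    unfolding p_def using t fin(1) S(3) by (intro sum_pos) auto
  moreover have "q t > 0" if t: "t \<in> f ` W" for t
    unfolding q_def using t fin(2) W(3) by (intro sum_pos) auto
  ultimately have eq: "\<kappa> ` S = f ` W"
    using coords_outside[OF p] coords_outside[OF q] pq by (metis less_irrefl subsetI subset_antisym)
  define Z where "Z = {z. pr1 z \<in> S \<and> pr2 z \<in> W \<and> \<kappa> (pr1 z) = f (pr2 z)}"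
  have Z: "Z \<in> P"
    unfolding pullback_complex_def Z_def using S(1) W(1) eq by blast
  have pr2Z: "pr2 ` Z = W"
  proof
    show "W \<subseteq> pr2 ` Z"
    proof
      fix v assume v: "v \<in> W"
      then obtain s where "s \<in> S" "\<kappa> s = f v"
        using eq by (metis imageE imageI)
      then have "pair_rinf s v \<in> Z"
        using v by (simp add: Z_def)
      then show "v \<in> pr2 ` Z"
        by (metis image_eqI pr2_pair_rinf)
    qed
  qed (auto simp: Z_def)
  \<comment> \<open>A point of the hull of \<open>Z\<close> with the right second component is found
    first; its first component is then forced by injectivity of \<open>\<kappa>\<close> on
    \<open>V\<close>.\<close>
  have "pr2 z \<in> pr2 ` (convex hull Z)"
    using coords_in_hull[OF W(2) fin(2)] pr2Z
      affine_image_hull[OF affine_on_simplex_linear[OF linear_pr2] pullback_finite[OF Z]] by simp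
  then obtain z' where z': "z' \<in> convex hull Z" "pr2 z = pr2 z'"
    by blast
  then obtain c where c: "coords Z c z'"
    using in_convex_hull_iff_coords[OF pullback_finite[OF Z]] by blast
  have sub: "pr1 ` Z \<subseteq> convex hull V"
    using V(2) by (auto simp: Z_def)
  have "\<kappa> (pr1 z') = (\<Sum>v\<in>Z. c v *\<^sub>R \<kappa> (pr1 v))"
    by (rule affine_on_simplexD[OF affine_on_simplex_compose[OF
            affine_on_simplex_linear[OF linear_pr1] \<kappa>_affine[OF V(1) sub] pullback_finite[OF Z]] c])
  also have "\<dots> = (\<Sum>v\<in>Z. c v *\<^sub>R f (pr2 v))"
    by (intro sum.cong) (auto simp: Z_def)
  also have "\<dots> = f (pr2 z')"
    using f(2) pr2Z
    by (intro affine_on_simplexD[OF affine_on_simplex_compose[OF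
            affine_on_simplex_linear[OF linear_pr2] _ pullback_finite[OF Z]] c, symmetric]) simp
  finally have "\<kappa> (pr1 z') = \<kappa> (pr1 z)"
    using z(3) z'(2) by simp
  moreover have "pr1 z' \<in> convex hull V"
    using coords_in_hull[OF coords_image[OF affine_on_simplex_linear[OF linear_pr1] c pullback_finite[OF Z]]]
      pullback_finite[OF Z] sub by (meson convex_convex_hull finite_imageI hull_minimal subsetD)
  moreover have "pr1 z \<in> convex hull V"
    using coords_in_hull[OF S(2) fin(1)] V(2) by (meson convex_convex_hull hull_minimal subsetD)
  ultimately have "pr1 z' = pr1 z"
    using inj_onD[OF \<kappa>_inj[OF V(1)]] by blast
  then have "z = z'"
    using pr_eqI[OF _ z'(2)] by simp
  then show "z \<in> underlying P"
    using z'(1) Z unfolding underlying_def by blast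
qed

end

text \<open>Compatibility over the standard simplex preserves the pull-back equation. The second
  component is untouched and already separates the vertices of a simplex, which gives
  injectivity.\<close>

lemma nondegenerate_map_pullback:
  assumes "pullback_over n \<tau> A \<kappa>A L f" "pullback_over n \<tau> B \<kappa>B L f"
    and h: "nondegenerate_map A B h" and \<kappa>: "\<And>x. x \<in> underlying A \<Longrightarrow> \<kappa>B (h x) = \<kappa>A x"
  shows "nondegenerate_map (pullback_complex L \<tau> f A \<kappa>A) (pullback_complex L \<tau> f B \<kappa>B)
    (\<lambda>z. pair_rinf (h (pr1 z)) (pr2 z))"
    (is "nondegenerate_map _ _ ?H")
proof -
  interpret A: pullback_over n \<tau> A \<kappa>A L f
    by (rule assms(1))
  interpret B: pullback_over n \<tau> B \<kappa>B L f
    by (rule assms(2))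
  show ?thesis
    unfolding nondegenerate_map_def simplicial_map_def
  proof (intro conjI ballI)
    fix Z assume Z: "Z \<in> A.P"
    obtain V where V: "V \<in> A" "pr1 ` Z \<subseteq> convex hull V"
      using Z A.in_pullback_complex by blast
    have aff: "affine_on_simplex V h"
      by (rule nondegenerate_mapD(2)[OF h V(1)])
    have "pr1 ` ?H ` Z = h ` pr1 ` Z" "pr2 ` ?H ` Z = pr2 ` Z"
      by (simp_all add: image_image)
    moreover have "h ` pr1 ` Z \<subseteq> convex hull (h ` V)"
      using V affine_image_hull[OF aff] simplex_finite[OF A.complex_K] by blast
    moreover have "h ` V \<in> B"
      by (rule nondegenerate_mapD(1)[OF h V(1)])
    moreover have "\<kappa>B (pr1 (?H z)) = f (pr2 (?H z))" if "z \<in> Z" for z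
    proof -
      have "pr1 z \<in> underlying A"
        using V that unfolding underlying_def by blast
      then show ?thesis
        using \<kappa> that Z by (simp add: A.in_pullback_complex)
    qed
    moreover have "pr2 ` Z \<in> L"
      using Z A.in_pullback_complex by blast
    ultimately show "?H ` Z \<in> B.P"
      unfolding B.in_pullback_complex by auto
    show "affine_on_simplex Z ?H"
      using affine_on_simplex_compose[OF affine_on_simplex_linear[OF linear_pr1]
          affine_on_simplex_subset_hull[OF aff V(2) simplex_finite[OF A.complex_K V(1)]]
          A.pullback_finite[OF Z]] affine_on_simplex_linear[OF linear_pr2]
      by (intro affine_on_simplex_pair_rinf)
    show "inj_on ?H Z"
    proof (rule inj_onI)
      fix z w assume "z \<in> Z" "w \<in> Z" "?H z = ?H w"
      then show "z = w"
        using inj_onD[OF A.pullback_pr2_inj[OF Z]] by (metis pr2_pair_rinf)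
    qed
  qed
qed

section \<open>Functoriality of the pull-back step\<close>

lemma subdivides_trans: "subdivides A B \<Longrightarrow> subdivides B C \<Longrightarrow> subdivides A C"
  unfolding subdivides_def by (metis subset_trans)

lemma subdivides_barycentric_subdivision:
  assumes "finite_complex K"
  shows "subdivides (barycentric_subdivision K) K"
  unfolding subdivides_def
  by (intro conjI ballI finite_complex_barycentric_subdivision[OF assms] assms
      underlying_barycentric_subdivision[OF assms] barycentric_subdivision_hull_subset[OF assms])

text \<open>An edge collapsed by the map would be a connected set inside a zero-dimensional fibre.\<close>

lemma light_simplicial_imp_nondegenerate:
  assumes K: "finite_complex (K :: 'a::real_normed_vector set set)"
    and g: "simplicial_map K K' g" and light: "light_on (underlying K) g"
  shows "nondegenerate_map K K' g"
  unfolding nondegenerate_map_def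
proof (intro conjI ballI g)
  fix V assume V: "V \<in> K"
  show "inj_on g V"
  proof (rule inj_onI, rule ccontr)
    fix v w assume vw: "v \<in> V" "w \<in> V" "g v = g w" "v \<noteq> w"
    define F where "F = {x \<in> underlying K. g x = g v}"
    have aff: "affine_on_simplex {v, w} g"
      using affine_on_simplex_subset[of V g "{v, w}"] g V vw simplex_finite[OF K V]
      by (simp add: simplicial_map_def)
    have "g x = g v" if "x \<in> convex hull {v, w}" for x
    proof -
      have "g x \<in> g ` (convex hull {v, w})"
        using that by blast
      also have "\<dots> = convex hull (g ` {v, w})"
        by (rule affine_image_hull[OF aff]) simp
      also have "\<dots> = {g v}"
        using vw(3) by simp
      finally show ?thesis by simp
    qed
    moreover have "convex hull {v, w} \<subseteq> convex hull V"
      using vw by (intro hull_mono) simp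
    ultimately have sub: "convex hull {v, w} \<subseteq> F"
      using V by (auto simp: F_def underlying_def)
    then have F: "v \<in> F" "w \<in> F"
      using hull_subset[of "{v, w}" convex] by blast+
    have "neighbourhood_base_of (\<lambda>U. closedin (top_of_set F) U \<and> openin (top_of_set F) U) (top_of_set F)"
      using light unfolding light_on_def F_def by (simp add: dimension_le_0_neighbourhood_base_of_clopen)
    moreover have "openin (top_of_set F) (F - {w})"
      unfolding Diff_eq by (intro openin_open_Int open_Compl closed_singleton)
    ultimately obtain U where U: "closedin (top_of_set F) U" "openin (top_of_set F) U" "v \<in> U" "U \<subseteq> F - {w}"
      using F vw(4) unfolding neighbourhood_base_of by blast
    have "connected (convex hull {v, w})"
      by (simp add: convex_connected)
    then have "connectedin (top_of_set F) (convex hull {v, w})"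
      using sub by (simp add: connectedin_subtopology)
    then have "convex hull {v, w} \<subseteq> U \<or> disjnt (convex hull {v, w}) U"
      using U(1,2) by (simp add: connectedin_clopen_cases)
    then show False
      using U(3,4) hull_subset[of "{v, w}" convex] by (auto simp: disjnt_iff)
  qed
qed

section \<open>Single simplices as complexes\<close>

definition faces :: "'a set \<Rightarrow> 'a set set" where
  "faces V = {W. W \<subseteq> V \<and> W \<noteq> {}}"

lemma finite_complex_subcomplex:
  assumes "finite_complex K" "A \<subseteq> K" "\<And>V W. V \<in> A \<Longrightarrow> W \<subseteq> V \<Longrightarrow> W \<noteq> {} \<Longrightarrow> W \<in> A"
  shows "finite_complex A"
  unfolding finite_complex_def
proof (intro conjI)
  show "finite A"
    using finite_subset[OF assms(2)] finite_complex_finite[OF assms(1)] by blast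
  show "\<forall>V\<in>A. \<forall>W. W \<subseteq> V \<and> W \<noteq> {} \<longrightarrow> W \<in> A"
    using assms(3) by blast
  show "\<forall>V\<in>A. finite V \<and> V \<noteq> {} \<and> \<not> affine_dependent V"
    "\<forall>V\<in>A. \<forall>W\<in>A. convex hull V \<inter> convex hull W = convex hull (V \<inter> W)"
    using assms(1,2) unfolding finite_complex_def by (meson subsetD)+
qed

lemma finite_complex_faces:
  assumes "finite_complex K" "V \<in> K"
  shows "finite_complex (faces V)"
proof (rule finite_complex_subcomplex[OF assms(1)])
  show "faces V \<subseteq> K"
    using simplex_face[OF assms] by (auto simp: faces_def)
qed (auto simp: faces_def)

lemma underlying_faces:
  assumes "V \<noteq> {}"
  shows "underlying (faces V) = convex hull V"
proof
  show "underlying (faces V) \<subseteq> convex hull V"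
    unfolding underlying_def faces_def using hull_mono by blast
  have "V \<in> faces V"
    using assms by (simp add: faces_def)
  then show "convex hull V \<subseteq> underlying (faces V)"
    unfolding underlying_def by blast
qed

lemma nondegenerate_faces_inclusion:
  assumes "finite_complex K" "V \<in> K"
  shows "nondegenerate_map (faces V) K id"
  unfolding nondegenerate_map_def simplicial_map_def
  using simplex_face[OF assms] by (simp add: faces_def affine_on_simplex_id)

text \<open>
  Every simplex is compared with a standard one, where barycentric coordinates are visibly continuous.
\<close>

lemma simplex_homeomorphic_std_simplex:
  fixes V :: "rinf set"
  assumes K: "finite_complex K" and V: "V \<in> K" and card: "card V = Suc m"
  obtains h g where "nondegenerate_map (std_simplex m) (faces V) h"
    "nondegenerate_map (faces V) (std_simplex m) g"
    "homeomorphism (underlying (std_simplex m)) (underlying (faces V)) h g"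
proof -
  have fin: "finite V" and ne: "V \<noteq> {}"
    using simplex_finite[OF K V] simplex_nonempty[OF K V] by simp_all
  have "card {..m} = card V"
    using card by simp
  then obtain e where e: "bij_betw e {..m} V"
    using fin bij_betw_iff_card[of "{..m}" V] by auto
  let ?E = "unit_vertex ` {..m}"
  define h where "h x = (\<Sum>i\<le>m. Poly_Mapping.lookup x i *\<^sub>R e i)" for x
  have lin: "bounded_linear h"
    unfolding h_def[abs_def]
    by (intro bounded_linear_sum bounded_linear_compose[OF bounded_linear_scaleR_left bounded_linear_lookup])
  have h_vertex: "h (unit_vertex i) = e i" if "i \<le> m" for i
    using that by (simp add: h_def lookup_unit_vertex if_distrib[of "\<lambda>r. r *\<^sub>R _"] cong: if_cong)
  have hE: "h ` ?E = V"
  proof -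
    have "h ` ?E = e ` {..m}"
      unfolding image_image by (intro image_cong) (auto simp: h_vertex)
    then show ?thesis
      using e by (simp add: bij_betw_def)
  qed
  have injE: "inj_on h ?E"
    using e h_vertex by (auto simp: inj_on_def bij_betw_def)
  have h: "nondegenerate_map (std_simplex m) (faces V) h"
    unfolding nondegenerate_map_def simplicial_map_def
  proof (intro conjI ballI)
    fix W assume W: "W \<in> std_simplex m"
    then have sub: "W \<subseteq> ?E" "W \<noteq> {}"
      by (simp_all add: std_simplex_def)
    show "h ` W \<in> faces V"
      using sub hE by (auto simp: faces_def)
    show "affine_on_simplex W h"
      by (rule affine_on_simplex_linear[OF bounded_linear.linear[OF lin]])
    show "inj_on h W"
      by (rule inj_on_subset[OF injE sub(1)])
  qed
  have E: "?E \<in> std_simplex m"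
    by (simp add: std_simplex_def)
  have inj: "inj_on h (convex hull ?E)"
    by (rule nondegenerate_map_inj_on_hull[OF h E finite_complex_std_simplex finite_complex_faces[OF K V]])
  have hhull: "h ` (convex hull ?E) = convex hull V"
    using affine_image_hull[OF affine_on_simplex_linear[OF bounded_linear.linear[OF lin]], of ?E] hE by simp
  have "compact (convex hull ?E)"
    by (simp add: finite_imp_compact_convex_hull)
  then obtain g where hom: "homeomorphism (convex hull ?E) (convex hull V) h g"
    using homeomorphism_compact[OF _ linear_continuous_on[OF lin] hhull inj] by blast
  have gh: "g (h x) = x" if "x \<in> convex hull ?E" for x
    using hom that by (simp add: homeomorphism_def)
  have g_vertex: "g ` W \<subseteq> ?E" "h ` g ` W = W" if "W \<subseteq> V" for W
  proof -
    have *: "g v \<in> ?E \<and> h (g v) = v" if v: "v \<in> V" for v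
    proof -
      obtain x where x: "x \<in> ?E" "v = h x"
        using v hE by blast
      then show ?thesis
        using gh[of x] hull_subset[of ?E convex] by auto
    qed
    then show "g ` W \<subseteq> ?E" "h ` g ` W = W"
      using that by (auto simp: image_image subset_iff)
  qed
  have g: "nondegenerate_map (faces V) (std_simplex m) g"
    unfolding nondegenerate_map_def simplicial_map_def
  proof (intro conjI ballI)
    fix W assume "W \<in> faces V"
    then have W: "W \<subseteq> V" "W \<noteq> {}"
      by (simp_all add: faces_def)
    show "g ` W \<in> std_simplex m"
      using g_vertex(1)[OF W(1)] W(2) by (simp add: std_simplex_def)
    have hg: "h (g v) = v" if "v \<in> V" for v
      using hom that hull_subset[of V convex] by (auto simp: homeomorphism_def)
    then show "inj_on g W"
      using W(1) by (metis inj_onI subsetD)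
    show "affine_on_simplex W g"
    proof (rule affine_on_simplexI)
      fix u x assume u: "coords W u x"
      let ?y = "\<Sum>v\<in>W. u v *\<^sub>R g v"
      have "h ?y = (\<Sum>v\<in>W. u v *\<^sub>R h (g v))"
        using bounded_linear.linear[OF lin] by (simp add: linear_sum linear_scale)
      also have "\<dots> = (\<Sum>v\<in>W. u v *\<^sub>R v)"
        using W(1) hg by (intro sum.cong) auto
      finally have "h ?y = x"
        using coords_sum[OF u] by simp
      moreover have "?y \<in> convex hull ?E"
        using u g_vertex(1)[OF W(1)] finite_subset[OF W(1) fin] unfolding coords_def
        by (intro convex_sum) (auto intro!: hull_inc)
      ultimately show "g x = ?y"
        using gh by metis
    qed
  qed
  show thesis
    using that[OF h g] hom underlying_faces[OF ne] underlying_std_simplex by simp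
qed

text \<open>The action of the pull-back step on maps: (x, y) goes to (h x, y). No complex enters the
  formula, so it can be iterated by itself.\<close>

definition lift_map :: "(rinf \<Rightarrow> rinf) \<Rightarrow> rinf \<Rightarrow> rinf" where
  "lift_map h z = pair_rinf (h (pr1 z)) (pr2 z)"

lemma lift_map_funpow_id: "(lift_map ^^ k) id = id"
proof (induction k)
  case (Suc k)
  then show ?case
    by (simp add: lift_map_def fun_eq_iff)
qed simp

text \<open>The commutation with the bonding maps that \<open>simplex_equiv\<close> demands, valid
  at every point.\<close>

lemma pr1_lift_map_funpow: "pr1 ((lift_map ^^ Suc k) h z) = (lift_map ^^ k) h (pr1 z)"
  by (simp add: lift_map_def)

section \<open>The pull-back step and its iterates\<close>

locale block_data =
  fixes n :: nat and L \<tau> :: "rinf set set" and f :: "rinf \<Rightarrow> rinf"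
  assumes complex_L: "finite_complex L" and card_L: "\<And>W. W \<in> L \<Longrightarrow> card W \<le> n + 1"
    and complex_\<tau>: "finite_complex \<tau>" and underlying_\<tau>: "underlying \<tau> = underlying (std_simplex n)"
    and simplicial_f: "simplicial_map L \<tau> f"
begin

text \<open>Unlike \<open>n_dimensional\<close>, this passes to subcomplexes, so the step applies to
  a single simplex of any dimension up to \<open>n\<close>.\<close>

definition small_complex :: "rinf set set \<Rightarrow> bool" where
  "small_complex M \<longleftrightarrow> finite_complex M \<and> (\<forall>V\<in>M. card V \<le> n + 1)"

text \<open>Subdivision comes before the pull-back here, so the step leads from one natural
  structure to the next and depends on the complex alone.\<close>

definition block_step :: "rinf set set \<Rightarrow> rinf set set" where
  "block_step M = pullback_complex L \<tau> f (barycentric_subdivision M) (barycentric_char M)"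

lemma pullback_overI:
  assumes "finite_complex K" "nondegenerate_map K (std_simplex n) \<kappa>"
  shows "pullback_over n \<tau> K \<kappa> L f"
  by unfold_locales (fact assms complex_\<tau> underlying_\<tau> complex_L simplicial_f)+

lemma small_complex_pullback:
  assumes "pullback_over n \<tau> K \<kappa> L f"
  shows "small_complex (pullback_complex L \<tau> f K \<kappa>)"
  unfolding small_complex_def
proof (intro conjI ballI)
  show "finite_complex (pullback_complex L \<tau> f K \<kappa>)"
    by (rule pullback_over.finite_complex_pullback[OF assms])
  fix Z assume "Z \<in> pullback_complex L \<tau> f K \<kappa>"
  then show "card Z \<le> n + 1"
    using pullback_over.pullback_card[OF assms] card_L by fastforce
qed

lemma pullback_over_barycentric:
  assumes "small_complex M"
  shows "pullback_over n \<tau> (barycentric_subdivision M) (barycentric_char M) L f"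
  using assms unfolding small_complex_def
  by (intro pullback_overI finite_complex_barycentric_subdivision nondegenerate_barycentric_char) auto

lemma small_complex_block_step: "small_complex M \<Longrightarrow> small_complex (block_step M)"
  unfolding block_step_def by (intro small_complex_pullback pullback_over_barycentric)

lemma small_complex_funpow: "small_complex M \<Longrightarrow> small_complex ((block_step ^^ k) M)"
  by (induction k) (auto intro: small_complex_block_step)

lemma underlying_block_step:
  assumes "small_complex M"
  shows "underlying (block_step M) =
    {z. pr1 z \<in> underlying M \<and> pr2 z \<in> underlying L \<and> barycentric_char M (pr1 z) = f (pr2 z)}"
  unfolding block_step_def pullback_over.underlying_pullback[OF pullback_over_barycentric[OF assms]]
  using assms by (simp add: underlying_barycentric_subdivision small_complex_def)

text \<open>Naturality of \<open>barycentric_char\<close> supplies the compatibility over the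
  standard simplex.\<close>

lemma nondegenerate_lift_map:
  assumes A: "small_complex A" and B: "small_complex B" and h: "nondegenerate_map A B h"
  shows "nondegenerate_map (block_step A) (block_step B) (lift_map h)"
proof -
  have fc: "finite_complex A" "finite_complex B"
    using A B by (simp_all add: small_complex_def)
  show ?thesis
    unfolding block_step_def lift_map_def[abs_def]
  proof (rule nondegenerate_map_pullback)
    show "nondegenerate_map (barycentric_subdivision A) (barycentric_subdivision B) h"
      by (rule nondegenerate_map_barycentric_subdivision[OF fc h])
    show "barycentric_char B (h x) = barycentric_char A x"
      if "x \<in> underlying (barycentric_subdivision A)" for x
      using barycentric_char_natural[OF fc h] that by (simp add: underlying_barycentric_subdivision[OF fc(1)])
  qed (fact pullback_over_barycentric[OF A] pullback_over_barycentric[OF B])+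
qed

lemma nondegenerate_lift_map_funpow:
  assumes "small_complex A" "small_complex B" "nondegenerate_map A B h"
  shows "nondegenerate_map ((block_step ^^ k) A) ((block_step ^^ k) B) ((lift_map ^^ k) h)"
  using assms by (induction k) (auto intro: nondegenerate_lift_map small_complex_funpow)

lemma lift_map_underlying:
  assumes "small_complex A" "small_complex B" "nondegenerate_map A B h" "z \<in> underlying (block_step A)"
  shows "lift_map h z \<in> underlying (block_step B)"
proof (rule simplicial_map_underlying[OF _ _ assms(4)])
  show "simplicial_map (block_step A) (block_step B) (lift_map h)"
    using nondegenerate_lift_map[OF assms(1-3)] by (simp add: nondegenerate_map_def)
  show "finite_complex (block_step A)"
    using small_complex_block_step[OF assms(1)] by (simp add: small_complex_def)
qed

text \<open>Continuity of \<open>h\<close> and \<open>g\<close> is known only on the polyhedra; this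
  is enough because \<open>pr1\<close> maps each new polyhedron into the old one.\<close>

lemma homeomorphism_lift_map:
  assumes A: "small_complex A" and B: "small_complex B"
    and h: "nondegenerate_map A B h" and g: "nondegenerate_map B A g"
    and hom: "homeomorphism (underlying A) (underlying B) h g"
  shows "homeomorphism (underlying (block_step A)) (underlying (block_step B)) (lift_map h) (lift_map g)"
proof (rule homeomorphismI)
  have pr1: "pr1 ` underlying (block_step M) \<subseteq> underlying M" if "small_complex M" for M
    using underlying_block_step[OF that] by blast
  have cont: "continuous_on S (lift_map k)" if "continuous_on (pr1 ` S) k" for S k
    unfolding lift_map_def[abs_def]
    by (rule continuous_on_pair_rinf[OF continuous_on_compose2[OF that linear_continuous_on[OF
              bounded_linear_pr1] subset_refl] linear_continuous_on[OF bounded_linear_pr2]])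
  show "continuous_on (underlying (block_step A)) (lift_map h)"
    by (rule cont[OF continuous_on_subset[OF homeomorphism_cont1[OF hom] pr1[OF A]]])
  show "continuous_on (underlying (block_step B)) (lift_map g)"
    by (rule cont[OF continuous_on_subset[OF homeomorphism_cont2[OF hom] pr1[OF B]]])
  show "lift_map h ` underlying (block_step A) \<subseteq> underlying (block_step B)"
    using lift_map_underlying[OF A B h] by blast
  show "lift_map g ` underlying (block_step B) \<subseteq> underlying (block_step A)"
    using lift_map_underlying[OF B A g] by blast
  show "lift_map g (lift_map h z) = z" if "z \<in> underlying (block_step A)" for z
    using homeomorphism_apply1[OF hom] that pr1[OF A] by (auto simp: lift_map_def)
  show "lift_map h (lift_map g z) = z" if "z \<in> underlying (block_step B)" for z
    using homeomorphism_apply2[OF hom] that pr1[OF B] by (auto simp: lift_map_def)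
qed

lemma homeomorphism_lift_map_funpow:
  assumes "small_complex A" "small_complex B" "nondegenerate_map A B h" "nondegenerate_map B A g"
    and "homeomorphism (underlying A) (underlying B) h g"
  shows "homeomorphism (underlying ((block_step ^^ k) A)) (underlying ((block_step ^^ k) B))
    ((lift_map ^^ k) h) ((lift_map ^^ k) g)"
proof (induction k)
  case (Suc k)
  then show ?case
    unfolding funpow.simps o_apply
    by (intro homeomorphism_lift_map small_complex_funpow nondegenerate_lift_map_funpow assms)
qed (use assms in simp)

text \<open>Naturality for the inclusion says that the characteristic map of \<open>A\<close> is the
  restriction of that of \<open>M\<close>, so the pull-back over \<open>A\<close> is the part of the
  pull-back over \<open>M\<close> lying above it.\<close>

lemma underlying_block_step_subcomplex:
  assumes A: "small_complex A" and M: "small_complex M" and incl: "nondegenerate_map A M id"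
  shows "underlying (block_step A) = {z \<in> underlying (block_step M). pr1 z \<in> underlying A}"
proof -
  have "finite_complex A" "finite_complex M"
    using A M by (simp_all add: small_complex_def)
  then have "barycentric_char M x = barycentric_char A x" "x \<in> underlying M" if "x \<in> underlying A" for x
    using barycentric_char_natural[OF _ _ incl that] simplicial_map_underlying[of A M id x] incl that
    by (simp_all add: nondegenerate_map_def)
  then show ?thesis
    unfolding underlying_block_step[OF A] underlying_block_step[OF M] by auto
qed

text \<open>The lift of an inclusion is again the identity, so the one-step statement can be
  repeated; the conditions on successive projections combine into one on the k-fold
  projection.\<close>

lemma underlying_funpow_subcomplex:
  assumes "small_complex A" "small_complex M" "nondegenerate_map A M id"
  shows "underlying ((block_step ^^ k) A) =
    {x \<in> underlying ((block_step ^^ k) M). (pr1 ^^ k) x \<in> underlying A}"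
proof (induction k)
  case 0
  show ?case
    using simplicial_map_underlying[of A M id] assms by (auto simp: nondegenerate_map_def small_complex_def)
next
  case (Suc k)
  have "nondegenerate_map ((block_step ^^ k) A) ((block_step ^^ k) M) id"
    using nondegenerate_lift_map_funpow[OF assms, of k] by (simp add: lift_map_funpow_id)
  note sub = underlying_block_step_subcomplex[OF small_complex_funpow[OF assms(1)]
      small_complex_funpow[OF assms(2)] this]
  have "pr1 z \<in> underlying ((block_step ^^ k) M)" if "z \<in> underlying (block_step ((block_step ^^ k) M))" for z
    using that unfolding underlying_block_step[OF small_complex_funpow[OF assms(2)]] by blast
  then show ?case
    unfolding funpow.simps(2)[of k block_step] o_apply sub Suc.IH funpow_Suc_right[of k pr1] by blast
qed

end

section \<open>The Markov property\<close>

lemma simplex_equivI: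
  assumes "V \<in> K i" "W \<in> K j"
    and "\<And>k. homeomorphism (simplex_preimage K \<phi> i V k) (simplex_preimage K \<phi> j W k) (h k) (g k)"
    and "\<And>k x. x \<in> simplex_preimage K \<phi> i V (Suc k) \<Longrightarrow> h k (\<phi> (i + k) x) = \<phi> (j + k) (h (Suc k) x)"
  shows "((i, V), (j, W)) \<in> simplex_equiv K \<phi>"
proof -
  have "\<exists>h g. \<forall>k. homeomorphism (simplex_preimage K \<phi> i V k) (simplex_preimage K \<phi> j W k) (h k) (g k) \<and>
      (\<forall>x\<in>simplex_preimage K \<phi> i V (Suc k). h k (\<phi> (i + k) x) = \<phi> (j + k) (h (Suc k) x))"
    by (rule exI[of _ h], rule exI[of _ g], blast intro: assms(3,4))
  then show ?thesis
    using assms(1,2) unfolding simplex_equiv_def by simp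
qed

lemma simplex_equiv_refl:
  assumes "V \<in> K i"
  shows "((i, V), (i, V)) \<in> simplex_equiv K \<phi>"
proof -
  have "homeomorphism S S (\<lambda>x. x) (\<lambda>x. x)" for S :: "'a set"
    by (simp add: homeomorphism_def)
  then show ?thesis
    using assms by (intro simplex_equivI[of _ _ _ _ _ _ "\<lambda>_ x. x" "\<lambda>_ x. x"]) auto
qed

lemma trans_simplex_equiv: "trans (simplex_equiv K \<phi>)"
proof (rule transI)
  fix a b c assume "(a, b) \<in> simplex_equiv K \<phi>" "(b, c) \<in> simplex_equiv K \<phi>"
  moreover obtain i V j W l U where abc: "a = (i, V)" "b = (j, W)" "c = (l, U)"
    by (cases a, cases b, cases c)
  ultimately obtain h g h' g' where mem: "V \<in> K i" "U \<in> K l"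
    and h: "\<And>k. homeomorphism (simplex_preimage K \<phi> i V k) (simplex_preimage K \<phi> j W k) (h k) (g k)"
      "\<And>k x. x \<in> simplex_preimage K \<phi> i V (Suc k) \<Longrightarrow> h k (\<phi> (i + k) x) = \<phi> (j + k) (h (Suc k) x)"
    and h': "\<And>k. homeomorphism (simplex_preimage K \<phi> j W k) (simplex_preimage K \<phi> l U k) (h' k) (g' k)"
      "\<And>k x. x \<in> simplex_preimage K \<phi> j W (Suc k) \<Longrightarrow> h' k (\<phi> (j + k) x) = \<phi> (l + k) (h' (Suc k) x)"
    unfolding simplex_equiv_def by blast
  have comm: "(h' k \<circ> h k) (\<phi> (i + k) x) = \<phi> (l + k) ((h' (Suc k) \<circ> h (Suc k)) x)"
    if x: "x \<in> simplex_preimage K \<phi> i V (Suc k)" for k x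
  proof -
    have "h (Suc k) x \<in> simplex_preimage K \<phi> j W (Suc k)"
      using homeomorphism_image1[OF h(1)[of "Suc k"]] x by blast
    then show ?thesis
      using h(2)[OF x] h'(2) by simp
  qed
  show "(a, c) \<in> simplex_equiv K \<phi>"
    unfolding abc by (rule simplex_equivI[OF mem homeomorphism_compose[OF h(1) h'(1)] comm])
qed

text \<open>The class of \<open>a\<close> equals that of the representative chosen for
  \<open>c a\<close>: the two are related in both directions, and transitivity makes their classes
  equal. So there are at most as many classes as values of \<open>c\<close>.\<close>

lemma finite_quotient_by_invariant:
  assumes R: "trans R" and fin: "finite (c ` A)"
    and inv: "\<And>a b. a \<in> A \<Longrightarrow> b \<in> A \<Longrightarrow> c a = c b \<Longrightarrow> (a, b) \<in> R"
  shows "finite (A // R)"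
proof -
  define r where "r y = (SOME a. a \<in> A \<and> c a = y)" for y
  have "A // R \<subseteq> (\<lambda>y. R `` {r y}) ` c ` A"
  proof
    fix X assume "X \<in> A // R"
    then obtain a where a: "a \<in> A" "X = R `` {a}"
      by (auto simp: quotient_def)
    have r: "r (c a) \<in> A" "c (r (c a)) = c a"
      using someI[of "\<lambda>b. b \<in> A \<and> c b = c a" a] a(1) by (simp_all add: r_def)
    have "R `` {a} = R `` {r (c a)}"
      using inv[OF a(1) r(1)] inv[OF r(1) a(1)] r(2) R by (auto dest: transD)
    then show "X \<in> (\<lambda>y. R `` {r y}) ` c ` A"
      using a by blast
  qed
  then show ?thesis
    using fin finite_subset by blast
qed

text \<open>The limit is a closed subspace of a countable product of compact metrizable polyhedra,
  since each compatibility equation is an equality of two continuous maps into a Hausdorff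
  space.\<close>

lemma inverse_limit_compact_metrizable:
  fixes K :: "nat \<Rightarrow> 'a::real_normed_vector set set"
  assumes fin: "\<And>i. finite_complex (K i)" and cont: "\<And>i. continuous_on UNIV (\<phi> i)"
  shows "compact_space (inverse_limit K \<phi>)" "metrizable_space (inverse_limit K \<phi>)"
proof -
  let ?X = "product_topology (\<lambda>i. top_of_set (underlying (K i))) UNIV"
  have "metrizable_space (top_of_set (underlying (K i)))" for i
    by (intro metrizable_space_subtopology metrizable_space_euclidean)
  then have "metrizable_space ?X"
    by (simp add: metrizable_space_product_topology)
  then show "metrizable_space (inverse_limit K \<phi>)"
    unfolding inverse_limit_def by (rule metrizable_space_subtopology)
  have "compact (underlying (K i))" for i
    unfolding underlying_def
    by (intro compact_UN finite_complex_finite[OF fin] finite_imp_compact_convex_hull simplex_finite[OF fin])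
  then have comp: "compact_space ?X"
    by (simp add: compact_space_product_topology compact_space_subtopology)
  have proj: "continuous_map ?X euclidean (\<lambda>x. x i)" for i
    using continuous_map_product_projection[of i UNIV "\<lambda>i. top_of_set (underlying (K i))"]
    by (simp add: continuous_map_in_subtopology)
  have "continuous_map ?X euclidean (\<lambda>x. \<phi> i (x (Suc i)))" for i
    using continuous_map_compose[OF proj[of "Suc i"], of euclidean "\<phi> i"] cont[of i]
    by (simp add: o_def)
  then have "closedin ?X {x \<in> topspace ?X. \<phi> i (x (Suc i)) = x i}" for i
    by (intro closedin_continuous_maps_eq[OF _ _ proj]) auto
  then have "closedin ?X (\<Inter>i. {x \<in> topspace ?X. \<phi> i (x (Suc i)) = x i})"
    by (intro closedin_Inter) auto
  moreover have "(\<Inter>i. {x \<in> topspace ?X. \<phi> i (x (Suc i)) = x i}) =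
      topspace ?X \<inter> {x. \<forall>i. \<phi> i (x (Suc i)) = x i}"
    by blast
  ultimately have "compactin ?X (topspace ?X \<inter> {x. \<forall>i. \<phi> i (x (Suc i)) = x i})"
    using closedin_compact_space[OF comp] by simp
  from compact_space_subtopology[OF this] show "compact_space (inverse_limit K \<phi>)"
    unfolding inverse_limit_def by (simp only: subtopology_restrict)
qed

lemma bonding_constant: "bonding (\<lambda>_. p) i k = p ^^ k"
  by (induction k) (simp_all add: funpow_Suc_right del: funpow.simps)

section \<open>The natural stages and their simplex classes\<close>

locale block_sequence = block_data +
  fixes K\<^sub>0 :: "rinf set set" and \<kappa>\<^sub>0 :: "rinf \<Rightarrow> rinf"
  assumes small_K\<^sub>0: "small_complex K\<^sub>0"
    and nondegenerate_\<kappa>\<^sub>0: "nondegenerate_map K\<^sub>0 (std_simplex n) \<kappa>\<^sub>0"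
begin

abbreviation "stage \<equiv> block_stage L \<tau> f K\<^sub>0 \<kappa>\<^sub>0"

text \<open>Each pull-back before its barycentric subdivision; the initial complex is kept as
  given.\<close>

definition natural_stage :: "nat \<Rightarrow> rinf set set" where
  "natural_stage i =
     (case i of 0 \<Rightarrow> K\<^sub>0 | Suc i \<Rightarrow> pullback_complex L \<tau> f (fst (stage i)) (snd (stage i)))"

lemma natural_stage_0 [simp]: "natural_stage 0 = K\<^sub>0"
  and natural_stage_Suc: "natural_stage (Suc i) = pullback_complex L \<tau> f (fst (stage i)) (snd (stage i))"
  by (simp_all add: natural_stage_def)

lemma stage_Suc:
  "fst (stage (Suc i)) = barycentric_subdivision (natural_stage (Suc i))"
  "snd (stage (Suc i)) = barycentric_char (natural_stage (Suc i))"
  by (simp_all add: natural_stage_Suc Let_def case_prod_unfold)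

text \<open>From index 1 on the characteristic map is \<open>barycentric_char\<close>. The first
  step uses \<open>\<kappa>\<^sub>0\<close> instead, which is why the uniform statements below
  concern indices \<open>Suc i\<close>.\<close>

lemma natural_stage_Suc_Suc: "natural_stage (Suc (Suc i)) = block_step (natural_stage (Suc i))"
  unfolding natural_stage_Suc[of "Suc i"] stage_Suc block_step_def ..

lemma small_natural_stage: "small_complex (natural_stage i)"
proof (induction i)
  case (Suc i)
  show ?case
  proof (cases i)
    case 0
    have "pullback_over n \<tau> K\<^sub>0 \<kappa>\<^sub>0 L f"
      using small_K\<^sub>0 nondegenerate_\<kappa>\<^sub>0 by (simp add: small_complex_def pullback_overI)
    then show ?thesis
      using 0 by (simp add: natural_stage_Suc small_complex_pullback)
  next
    case (Suc j)
    then show ?thesis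
      using Suc.IH by (simp add: natural_stage_Suc_Suc small_complex_block_step)
  qed
qed (simp add: small_K\<^sub>0)

lemma complex_natural_stage: "finite_complex (natural_stage i)"
  using small_natural_stage by (simp add: small_complex_def)

lemma pullback_over_stage: "pullback_over n \<tau> (fst (stage i)) (snd (stage i)) L f"
proof (cases i)
  case 0
  then show ?thesis
    using small_K\<^sub>0 nondegenerate_\<kappa>\<^sub>0 by (simp add: small_complex_def pullback_overI)
next
  case (Suc j)
  show ?thesis
    unfolding Suc stage_Suc by (rule pullback_over_barycentric[OF small_natural_stage])
qed

lemma subdivides_stage: "subdivides (fst (stage i)) (natural_stage i)"
proof (cases i)
  case 0
  then show ?thesis
    using complex_natural_stage[of 0] by (auto simp: subdivides_def)
next
  case (Suc j)
  show ?thesis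
    unfolding Suc stage_Suc by (rule subdivides_barycentric_subdivision[OF complex_natural_stage])
qed

text \<open>The subdivision for which \<open>pr1\<close> is simplicial is the one induced by
  \<open>\<tau>\<close> on \<open>fst (stage i)\<close>, which in turn subdivides the natural
  stage.\<close>

lemma inverse_sequence_natural_stage: "inverse_sequence natural_stage (\<lambda>i. pr1)"
  unfolding inverse_sequence_def
proof (intro allI conjI exI)
  fix i
  interpret pullback_over n \<tau> "fst (stage i)" "snd (stage i)" L f
    by (rule pullback_over_stage)
  show "finite_complex (natural_stage i)"
    by (rule complex_natural_stage)
  show "subdivides (induced_subdivision \<tau> (fst (stage i)) (snd (stage i))) (natural_stage i)"
    by (rule subdivides_trans[OF subdivides_induced_subdivision subdivides_stage])
  show "simplicial_map (natural_stage (Suc i)) (induced_subdivision \<tau> (fst (stage i)) (snd (stage i))) pr1"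
    unfolding natural_stage_Suc by (rule simplicial_map_pr1)
qed

text \<open>Subdivision leaves the underlying sets unchanged, and \<open>inverse_limit\<close> sees
  nothing else of the complexes.\<close>

lemma inverse_limit_natural_stage:
  "inverse_limit natural_stage (\<lambda>i. pr1) = inverse_limit (\<lambda>i. fst (stage i)) (\<lambda>i. pr1)"
  using subdivides_stage by (simp add: inverse_limit_def subdivides_def)

lemma natural_stage_funpow: "natural_stage (Suc i + k) = (block_step ^^ k) (natural_stage (Suc i))"
  by (induction k) (simp_all add: natural_stage_Suc_Suc)

lemma small_faces:
  assumes "V \<in> natural_stage i"
  shows "small_complex (faces V)"
proof -
  have "card W \<le> n + 1" if "W \<in> faces V" for W
    using small_natural_stage[of i] assms simplex_face[OF complex_natural_stage assms, of W] that
    by (auto simp: small_complex_def faces_def)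
  then show ?thesis
    using finite_complex_faces[OF complex_natural_stage assms] by (simp add: small_complex_def)
qed

text \<open>Functoriality for the inclusion of a face: the right-hand side no longer depends on the
  complex around \<open>V\<close>.\<close>

lemma simplex_preimage_natural_stage:
  assumes "V \<in> natural_stage (Suc i)"
  shows "simplex_preimage natural_stage (\<lambda>i. pr1) (Suc i) V k = underlying ((block_step ^^ k) (faces V))"
  unfolding simplex_preimage_def bonding_constant natural_stage_funpow
    underlying_funpow_subcomplex[OF small_faces[OF assms] small_natural_stage
      nondegenerate_faces_inclusion[OF complex_natural_stage assms]]
    underlying_faces[OF simplex_nonempty[OF complex_natural_stage assms]] ..

lemma simplex_equiv_of_card_eq:
  assumes V: "V \<in> natural_stage (Suc i)" and W: "W \<in> natural_stage (Suc j)" and card: "card V = card W"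
  shows "((Suc i, V), (Suc j, W)) \<in> simplex_equiv natural_stage (\<lambda>i. pr1)"
proof -
  note fc = complex_natural_stage
  have "card V \<noteq> 0"
    using simplex_finite[OF fc V] simplex_nonempty[OF fc V] by simp
  then obtain m where m: "card V = Suc m" "card W = Suc m"
    using card not0_implies_Suc by auto
  have "small_complex (natural_stage (Suc i))"
    by (rule small_natural_stage)
  then have "m \<le> n"
    using V m by (auto simp: small_complex_def)
  have S: "small_complex (std_simplex m)"
    unfolding small_complex_def
  proof (intro conjI ballI finite_complex_std_simplex)
    fix U assume "U \<in> std_simplex m"
    then have "card U \<le> card (unit_vertex ` {..m})"
      by (intro card_mono) (auto simp: std_simplex_def)
    also have "\<dots> \<le> m + 1"
      using card_image_le[of "{..m}" unit_vertex] by simp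
    finally show "card U \<le> n + 1"
      using \<open>m \<le> n\<close> by simp
  qed
  obtain h g where h: "nondegenerate_map (std_simplex m) (faces V) h"
      "nondegenerate_map (faces V) (std_simplex m) g"
      "homeomorphism (underlying (std_simplex m)) (underlying (faces V)) h g"
    using simplex_homeomorphic_std_simplex[OF fc V m(1)] by blast
  obtain h' g' where h': "nondegenerate_map (std_simplex m) (faces W) h'"
      "nondegenerate_map (faces W) (std_simplex m) g'"
      "homeomorphism (underlying (std_simplex m)) (underlying (faces W)) h' g'"
    using simplex_homeomorphic_std_simplex[OF fc W m(2)] by blast
  \<comment> \<open>From the tower over \<open>V\<close> down to that of the standard simplex of the
    same dimension, and up to the tower over \<open>W\<close>; \<open>?G\<close> is the way
    back.\<close>
  let ?F = "\<lambda>k. (lift_map ^^ k) h' \<circ> (lift_map ^^ k) g"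
  let ?G = "\<lambda>k. (lift_map ^^ k) h \<circ> (lift_map ^^ k) g'"
  have "homeomorphism (simplex_preimage natural_stage (\<lambda>i. pr1) (Suc i) V k)
      (simplex_preimage natural_stage (\<lambda>i. pr1) (Suc j) W k) (?F k) (?G k)" for k
    unfolding simplex_preimage_natural_stage[OF V] simplex_preimage_natural_stage[OF W]
    by (rule homeomorphism_compose[OF
          homeomorphism_symD[OF homeomorphism_lift_map_funpow[OF S small_faces[OF V] h]]
          homeomorphism_lift_map_funpow[OF S small_faces[OF W] h']])
  moreover have "?F k (pr1 x) = pr1 (?F (Suc k) x)" for k x
    by (simp only: o_apply pr1_lift_map_funpow)
  ultimately show ?thesis
    using V W by (intro simplex_equivI[where h = ?F and g = ?G]) simp_all
qed

lemma markov_natural_stage: "markov_sequence natural_stage (\<lambda>i. pr1)"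
  unfolding markov_sequence_def
proof (intro conjI inverse_sequence_natural_stage)
  \<comment> \<open>At stage 0 the invariant remembers the simplex itself; later the dummy
    \<open>{}\<close> takes its place and only the number of vertices remains. The Boolean keeps the
    two cases apart.\<close>
  define c where "c p = (fst p = 0, if fst p = 0 then snd p else {}, card (snd p))" for p :: "nat \<times> rinf set"
  show "finite (all_simplices natural_stage // simplex_equiv natural_stage (\<lambda>i. pr1))"
  proof (rule finite_quotient_by_invariant[OF trans_simplex_equiv])
    have "c ` all_simplices natural_stage \<subseteq> UNIV \<times> insert {} K\<^sub>0 \<times> {..n + 1}"
    proof
      fix y assume "y \<in> c ` all_simplices natural_stage"
      then obtain i V where V: "V \<in> natural_stage i" "y = c (i, V)"
        by (auto simp: all_simplices_def)
      then have "card V \<le> n + 1"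
        using small_natural_stage[of i] by (simp add: small_complex_def)
      then show "y \<in> UNIV \<times> insert {} K\<^sub>0 \<times> {..n + 1}"
        using V by (auto simp: c_def)
    qed
    then show "finite (c ` all_simplices natural_stage)"
    proof (rule finite_subset)
      show "finite ((UNIV :: bool set) \<times> insert {} K\<^sub>0 \<times> {..n + 1})"
        using finite_complex_finite[OF complex_natural_stage[of 0]] by (intro finite_cartesian_product) auto
    qed
  next
    fix a b assume a: "a \<in> all_simplices natural_stage" and b: "b \<in> all_simplices natural_stage"
      and eq: "c a = c b"
    obtain i V j W where ab: "a = (i, V)" "b = (j, W)"
      by (cases a, cases b)
    have VW: "V \<in> natural_stage i" "W \<in> natural_stage j"
      using a b ab by (simp_all add: all_simplices_def)
    show "(a, b) \<in> simplex_equiv natural_stage (\<lambda>i. pr1)"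
    proof (cases i)
      case 0
      then have "a = b"
        using eq by (auto simp: c_def ab split: if_splits)
      then show ?thesis
        using simplex_equiv_refl[of V natural_stage i] VW(1) ab by simp
    next
      case (Suc i')
      then obtain j' where "j = Suc j'" "card V = card W"
        using eq by (cases j) (auto simp: c_def ab)
      then show ?thesis
        using simplex_equiv_of_card_eq VW Suc ab by simp
    qed
  qed
qed

end

theorem proposition1p4:
  fixes n :: nat and L \<tau> :: "rinf set set" and f :: "rinf \<Rightarrow> rinf" and X :: "'x topology"
  assumes "building_block n L \<tau> f"
    and "compactum_defined_by n L \<tau> f X"
  shows "markov_compactum X"
proof -
  obtain K\<^sub>0 \<kappa>\<^sub>0 where over: "complex_over n K\<^sub>0 \<kappa>\<^sub>0"
    and hom: "X homeomorphic_space inverse_limit (\<lambda>i. fst (block_stage L \<tau> f K\<^sub>0 \<kappa>\<^sub>0 i)) (\<lambda>i. pr1)"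
    using assms(2) unfolding compactum_defined_by_def by blast
  interpret block_data n L \<tau> f
    using assms(1)
    by unfold_locales (auto simp: building_block_def symmetric_triangulation_def n_dimensional_def)
  interpret block_sequence n L \<tau> f K\<^sub>0 \<kappa>\<^sub>0
  proof unfold_locales
    show "small_complex K\<^sub>0"
      using over by (simp add: complex_over_def small_complex_def n_dimensional_def)
    show "nondegenerate_map K\<^sub>0 (std_simplex n) \<kappa>\<^sub>0"
      \<comment> \<open>The only place where lightness of \<open>\<kappa>\<^sub>0\<close>
        enters.\<close>
      using over unfolding complex_over_def by (intro light_simplicial_imp_nondegenerate) auto
  qed
  have hom: "X homeomorphic_space inverse_limit natural_stage (\<lambda>i. pr1)"
    using hom by (simp add: inverse_limit_natural_stage)
  have "continuous_on UNIV pr1"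
    by (rule linear_continuous_on[OF bounded_linear_pr1])
  then have "compact_space (inverse_limit natural_stage (\<lambda>i. pr1))"
      "metrizable_space (inverse_limit natural_stage (\<lambda>i. pr1))"
    by (intro inverse_limit_compact_metrizable complex_natural_stage; assumption)+
  then have "compact_space X" "metrizable_space X"
    by (simp_all add: homeomorphic_compact_space[OF hom] homeomorphic_metrizable_space[OF hom])
  then show ?thesis
    unfolding markov_compactum_def using markov_natural_stage hom by blast
qed

end
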